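(* Let $k\ge 2$, let $\lambda>0$, and let $F_1,\dots,F_k$ be continuous cumulative distribution functions supported on $[0,1]$ satisfying $$|F_i(x)-F_i(y)|\ \ge\ \lambda\,|x-y|\qquad\text{for all } x,y\in[0,1],\ i\in[k].$$ Let $\{(Y_j,Z_j)\}_{j=1}^n$ be $n$ i.i.d. samples from the first-price auction with bid distributions $F_1,\dots,F_k$. Let $\varepsilon,\delta\in(0,1)$. Then there is a polynomial-time algorithm that, given these samples, computes functions $\hat F_i$ for $i\in[k]$ such that, for all $i\in[k]$, $$\Pr\big(\mathcal W(\hat F_i,F_i)\le \varepsilon\big)\ \ge\ 1-\delta ,$$ assuming that $$n=\tilde\Theta\left(\left(\frac{2}{\lambda\,\varepsilon}\right)^{4k}\frac{\log(1/\delta)}{\varepsilon^2}\right).$$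
   Context: Notation: $[k]=\{1,\dots,k\}$. A cumulative distribution function (CDF) $F$ is supported on $[0,1]$ if $F(x)=0$ for all $x<0$ and $F(1)=1$. First-price auction data: a sample $(Y,Z)$ from the first-price auction with bid distributions $F_1,\dots,F_k$ is generated by drawing $X_i\sim F_i$ independently for $i\in[k]$ and observing $(Y,Z)=(\max_{i\in[k]}X_i,\ \arg\max_{i\in[k]}X_i)$. The number $k$ of bidders is known. Wasserstein distance: for distributions $P,Q$ on $[0,1]$, $\mathcal W(P,Q)=\inf_R \mathbb E_{(x,y)\sim R}|x-y|$ over all couplings $R$ of $P$ and $Q$ supported on $[0,1]^2$; distributions are identified with their CDFs. Order notation: constants hidden in $O,\Theta$ are absolute (independent of the distributions and of all parameters). The phrase "assuming $n=\tilde\Theta(f)$" means that there are absolute constants $C$ and $c\ge 1$ such that $n=C f\log^{c} f$ samples suffice for the conclusion. "Polynomial time" means polynomial in the number $n$ of samples.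
   Formalization: In the sample size, log(1/δ) is replaced by max(1, log(1/δ)); as stated, for δ near 1 the required n could be 0, where the claim fails. For δ ≤ 1/e nothing changes, and for δ bounded away from 1 only the absolute constants change. *)

theory Defs
  imports "HOL-Probability.Probability" "HOL-Computational_Algebra.Polynomial"
begin

section \<open>Distribution functions and the first-price auction\<close>

definition cdf_on_unit :: "(real \<Rightarrow> real) \<Rightarrow> bool" where
  "cdf_on_unit F \<longleftrightarrow>
     (\<exists>M. real_distribution M \<and> F = cdf M) \<and> (\<forall>x<0. F x = 0) \<and> F 1 = 1"

text \<open>Bidders are numbered \<open>1, \<dots>, k\<close>.  Ties are broken towards the smaller index; for
  continuous bid distributions they have probability 0.\<close>

definition auction_outcome :: "nat \<Rightarrow> (nat \<Rightarrow> real) \<Rightarrow> real \<times> nat" where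
  "auction_outcome k x =
     (Max (x ` {1..k}), LEAST i. i \<in> {1..k} \<and> x i = Max (x ` {1..k}))"

text \<open>\<^const>\<open>interval_measure\<close> \<open>F\<close> is the distribution on the reals whose CDF is \<open>F\<close>.\<close>

definition first_price_auction :: "nat \<Rightarrow> (nat \<Rightarrow> real \<Rightarrow> real) \<Rightarrow> (real \<times> nat) measure" where
  "first_price_auction k F =
     distr (\<Pi>\<^sub>M i\<in>{1..k}. interval_measure (F i)) (borel \<Otimes>\<^sub>M count_space UNIV) (auction_outcome k)"

definition auction_samples ::
    "nat \<Rightarrow> nat \<Rightarrow> (nat \<Rightarrow> real \<Rightarrow> real) \<Rightarrow> (nat \<Rightarrow> real \<times> nat) measure" where
  "auction_samples n k F = (\<Pi>\<^sub>M j\<in>{..<n}. first_price_auction k F)"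

section \<open>Wasserstein distance\<close>

definition coupling :: "real measure \<Rightarrow> real measure \<Rightarrow> (real \<times> real) measure \<Rightarrow> bool" where
  "coupling P Q R \<longleftrightarrow>
     prob_space R \<and> sets R = sets (borel \<Otimes>\<^sub>M borel) \<and>
     distr R borel fst = P \<and> distr R borel snd = Q \<and>
     (AE z in R. z \<in> {0..1} \<times> {0..1})"

text \<open>With values in \<^typ>\<open>ennreal\<close>, the distance is \<open>\<infinity>\<close> if there is no coupling.\<close>

definition wasserstein :: "real measure \<Rightarrow> real measure \<Rightarrow> ennreal" where
  "wasserstein P Q =
     (INF R\<in>{R. coupling P Q R}. \<integral>\<^sup>+ z. ennreal \<bar>fst z - snd z\<bar> \<partial>R)"

section \<open>Algorithms on real data\<close>

text \<open>The model of computation is the real RAM: memory consists of arrays of natural numbers and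
  arrays of exact real numbers (a scalar is an array used at index 0 only).  Reals admit the
  field operations and comparison.  There is deliberately no rounding or other conversion from
  reals to naturals and no multiplication of naturals, which at unit cost would make the model
  unrealistically strong.  The only constants are natural numbers.\<close>

type_synonym vname = string

datatype iexp =
    IConst nat
  | IGet vname iexp
  | IAdd iexp iexp
  | ISub iexp iexp

datatype rexp =
    ROfInt iexp
  | RGet vname iexp
  | RAdd rexp rexp
  | RSub rexp rexp
  | RMul rexp rexp
  | RDiv rexp rexp

datatype bexp =
    ILess iexp iexp
  | RLess rexp rexp
  | BNot bexp
  | BAnd bexp bexp

datatype com =
    Skip
  | ISet vname iexp iexp
  | RSet vname iexp rexp
  | Seq com com
  | Cond bexp com com
  | While bexp com

record memory =
  ints :: "vname \<Rightarrow> nat \<Rightarrow> nat"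
  reals :: "vname \<Rightarrow> nat \<Rightarrow> real"

primrec ival :: "iexp \<Rightarrow> memory \<Rightarrow> nat" where
  "ival (IConst c) s = c"
| "ival (IGet a e) s = ints s a (ival e s)"
| "ival (IAdd d e) s = ival d s + ival e s"
| "ival (ISub d e) s = ival d s - ival e s"

primrec rval :: "rexp \<Rightarrow> memory \<Rightarrow> real" where
  "rval (ROfInt e) s = real (ival e s)"
| "rval (RGet a e) s = reals s a (ival e s)"
| "rval (RAdd d e) s = rval d s + rval e s"
| "rval (RSub d e) s = rval d s - rval e s"
| "rval (RMul d e) s = rval d s * rval e s"
| "rval (RDiv d e) s = rval d s / rval e s"

primrec bval :: "bexp \<Rightarrow> memory \<Rightarrow> bool" where
  "bval (ILess d e) s \<longleftrightarrow> ival d s < ival e s"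
| "bval (RLess d e) s \<longleftrightarrow> rval d s < rval e s"
| "bval (BNot b) s \<longleftrightarrow> \<not> bval b s"
| "bval (BAnd b c) s \<longleftrightarrow> bval b s \<and> bval c s"

text \<open>\<open>exec c s t s'\<close>: program \<open>c\<close> started in \<open>s\<close> terminates in \<open>s'\<close> after \<open>t\<close> steps.  Every
  assignment and every test is one step, which is accurate up to a constant factor depending
  only on the program, since the expressions are part of the program text.\<close>

inductive exec :: "com \<Rightarrow> memory \<Rightarrow> nat \<Rightarrow> memory \<Rightarrow> bool" where
  Skip: "exec Skip s 1 s"
| ISet: "exec (ISet a d e) s 1
     (s\<lparr>ints := (ints s)(a := (ints s a)(ival d s := ival e s))\<rparr>)"
| RSet: "exec (RSet a d e) s 1
     (s\<lparr>reals := (reals s)(a := (reals s a)(ival d s := rval e s))\<rparr>)"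
| Seq: "exec c s t s' \<Longrightarrow> exec d s' u s'' \<Longrightarrow> exec (Seq c d) s (t + u) s''"
| CondTrue: "bval b s \<Longrightarrow> exec c s t s' \<Longrightarrow> exec (Cond b c d) s (t + 1) s'"
| CondFalse: "\<not> bval b s \<Longrightarrow> exec d s t s' \<Longrightarrow> exec (Cond b c d) s (t + 1) s'"
| WhileFalse: "\<not> bval b s \<Longrightarrow> exec (While b c) s 1 s"
| WhileTrue: "bval b s \<Longrightarrow> exec c s t s' \<Longrightarrow> exec (While b c) s' u s'' \<Longrightarrow>
     exec (While b c) s (t + u + 1) s''"

inductive_cases exec_elims:
  "exec Skip s t s'"
  "exec (ISet a d e) s t s'"
  "exec (RSet a d e) s t s'"
  "exec (Seq c d) s t s'"
  "exec (Cond b c d) s t s'"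
  "exec (While b c) s t s'"

lemma exec_deterministic:
  "exec c s t s' \<Longrightarrow> exec c s u s'' \<Longrightarrow> t = u \<and> s' = s''"
proof (induction arbitrary: u s'' rule: exec.induct)
  case (Skip s)
  then show ?case by (rule exec_elims(1)) simp
next
  case (ISet a d e s)
  then show ?case by (rule exec_elims(2)) simp
next
  case (RSet a d e s)
  then show ?case by (rule exec_elims(3)) simp
next
  case (Seq c s t s1 d v s2)
  show ?case using Seq.prems by (rule exec_elims(4)) (metis Seq.IH Seq.hyps)+
next
  case (CondTrue b s c t s1 d)
  show ?case using CondTrue.prems by (rule exec_elims(5)) (metis CondTrue.IH CondTrue.hyps Suc_eq_plus1)+
next
  case (CondFalse b s d t s1 c)
  show ?case using CondFalse.prems by (rule exec_elims(5)) (metis CondFalse.IH CondFalse.hyps Suc_eq_plus1)+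
next
  case (WhileFalse b s c)
  show ?case using WhileFalse.prems by (rule exec_elims(6)) (metis WhileFalse.hyps One_nat_def)+
next
  case (WhileTrue b s c t s1 v s2)
  show ?case using WhileTrue.prems by (rule exec_elims(6)) (metis WhileTrue.IH WhileTrue.hyps Suc_eq_plus1 add_Suc_right)+
qed

text \<open>The input consists of the numbers of samples and of bidders and the samples themselves.\<close>

definition input_memory :: "nat \<Rightarrow> nat \<Rightarrow> (nat \<Rightarrow> real \<times> nat) \<Rightarrow> memory" where
  "input_memory k n s =
     \<lparr>ints = (\<lambda>_ _. 0)
        (''n'' := (\<lambda>_. 0)(0 := n),
         ''k'' := (\<lambda>_. 0)(0 := k),
         ''Z'' := (\<lambda>j. if j < n then snd (s j) else 0)),
      reals = (\<lambda>_ _. 0)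
        (''Y'' := (\<lambda>j. if j < n then fst (s j) else 0))\<rparr>"

text \<open>The output functions are step functions with \<open>m\<close> common breakpoints \<open>b\<^sub>0, \<dots>, b\<^sub>m\<^sub>-\<^sub>1\<close>, in any
  order: function number \<open>i\<close> is \<open>x \<mapsto> \<Sum>l<m. w\<^sub>i\<^sub>l \<cdot> [b\<^sub>l \<le> x]\<close>, and the jump heights \<open>w\<^sub>i\<^sub>l\<close> are stored
  row by row in the array \<open>w\<close>.\<close>

definition output_function :: "memory \<Rightarrow> nat \<Rightarrow> real \<Rightarrow> real" where
  "output_function s i x =
     (let m = ints s ''m'' 0
      in \<Sum>l<m. if reals s ''b'' l \<le> x then reals s ''w'' ((i - 1) * m + l) else 0)"

text \<open>\<open>Fhat k n s i\<close> is the function computed for bidder \<open>i\<close> from the \<open>n\<close> samples \<open>s\<close>.  The time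
  bound is a polynomial in \<open>n\<close> alone, with the same program and polynomial for all \<open>k\<close>; since
  writing down \<open>k\<close> functions takes at least \<open>k\<close> steps, it is only required for \<open>k \<le> n\<close>.\<close>

definition computes_in_poly_time ::
    "com \<Rightarrow> (nat \<Rightarrow> nat \<Rightarrow> (nat \<Rightarrow> real \<times> nat) \<Rightarrow> nat \<Rightarrow> real \<Rightarrow> real) \<Rightarrow> bool" where
  "computes_in_poly_time A Fhat \<longleftrightarrow>
     (\<exists>p :: nat poly. \<forall>k n s. \<exists>t s'.
        exec A (input_memory k n s) t s' \<and>
        (k \<le> n \<longrightarrow> t \<le> poly p n) \<and>
        (\<forall>i\<in>{1..k}. Fhat k n s i = output_function s' i))"

section \<open>Sample size\<close>

text \<open>The rate \<open>f\<close> hidden in the \<open>\<Theta>\<close> notation.  The factor \<open>ln (1/\<delta>)\<close> vanishes as \<open>\<delta>\<close> tends to 1;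
  there \<open>f\<close> could drop to 1, where \<open>C * f * ln f powr c = 0\<close> samples would be claimed to suffice.
  Hence it is bounded below by 1, which has no effect for \<open>\<delta> \<le> 1/e\<close>.\<close>

definition sample_rate :: "nat \<Rightarrow> real \<Rightarrow> real \<Rightarrow> real \<Rightarrow> real" where
  "sample_rate k lam eps \<delta> =
     (2 / (lam * eps)) ^ (4 * k) * (max 1 (ln (1 / \<delta>)) / eps\<^sup>2)"

end

theory Submission
  imports Defs
begin

text \<open>With \<open>H = \<Prod>\<^sub>j F\<^sub>j\<close> the distribution function of the highest bid and \<open>H\<^sub>i\<close> its part won by bidder
  \<open>i\<close>, independence gives \<open>dF\<^sub>i / F\<^sub>i = dH\<^sub>i / H\<close>, and hence \<open>F\<^sub>i x = exp (- \<integral>\<^sub>x\<^sup>1 dH\<^sub>i / H)\<close>.  The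
  estimator is the corresponding Kaplan--Meier product
  \<open>\<Prod> {1 - 1 / N\<^sub>j | Z\<^sub>j = i, Y\<^sub>j > x}\<close> over the ranks \<open>N\<^sub>j\<close> of the samples.
  For \<open>x \<le> y\<close> let \<open>d\<close> be the probability of \<open>x < Y \<le> y\<close>, \<open>Z = i\<close>.  Then \<open>F\<^sub>i x / F\<^sub>i y\<close> lies between
  \<open>H x / (H x + d)\<close> and \<open>(H y - d) / H y\<close>, and the estimator satisfies exactly the same bounds with
  empirical frequencies.  On a grid with \<open>H (x\<^sub>q) = (1 - \<eta>)\<^sup>q\<close>, Hoeffding's inequality controls the
  frequencies and the errors of the ratios add up.  As \<open>F\<^sub>i x \<ge> lam * x\<close>, it suffices to go down to
  \<open>H \<ge> (lam * eps / 2) ^ k\<close>.  The lower bound on the slope of \<open>F\<^sub>i\<close> converts the uniform error into a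
  horizontal one, which bounds the cost of the quantile coupling.\<close>

section \<open>The program and its running time\<close>

text \<open>The ratio \<open>F i x / F i y\<close> is not determined by \<open>H x\<close>,
  \<open>H y\<close> and \<open>d\<close>, as it depends on how the wins of \<open>i\<close> are
  spread over the interval. The two bounds are the extreme cases, and they differ only to second
  order: by at most 2 \<eta>^2 if \<open>H\<close> keeps a fraction of at least 1 - \<eta>. About L
  / \<eta> ratios lead down to the lowest level h of \<open>H\<close>, so the gaps add up to order L
  * \<eta>, which can be made small; a first-order gap would leave order L. Only finitely many
  frequencies have to be estimated. Division by \<open>H\<close> amplifies a frequency error t to t
  / h. Keeping both L * \<eta> and (L / \<eta>) * (t / h) below \<mu> = lam * eps / 2 forces \<eta>
  of order \<mu> / L and t of order \<mu>^2 * h / L^2. Hoeffding's inequality asks for n of order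
  log / t^2, that is h^(-2) * \<mu>^(-4) * L^4 times a logarithm. With h = \<mu>^k and k \<ge> 2 the
  powers of \<mu> are at most \<mu>^(-4k), which is the exponent in the rate. The logarithm of the
  number of events adds one more factor L, hence the fifth power.\<close>

text \<open>Time is only bounded from above, so that both branches of a conditional and all rounds
  of a loop can share one bound.\<close>

definition runs :: "com \<Rightarrow> nat \<Rightarrow> memory \<Rightarrow> (memory \<Rightarrow> bool) \<Rightarrow> bool" where
  "runs c T s Q \<longleftrightarrow> (\<exists>t s'. exec c s t s' \<and> t \<le> T \<and> Q s')"

lemma runs_mono: "runs c T s Q \<Longrightarrow> T \<le> U \<Longrightarrow> runs c U s Q"
  unfolding runs_def by (meson le_trans)

lemma runs_weaken: "runs c T s Q \<Longrightarrow> (\<And>s'. Q s' \<Longrightarrow> R s') \<Longrightarrow> runs c T s R"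
  unfolding runs_def by blast

lemma runs_Skip: "Q s \<Longrightarrow> runs Skip 1 s Q"
  unfolding runs_def using exec.Skip by blast

lemma runs_ISet:
  "Q (s\<lparr>ints := (ints s)(a := (ints s a)(ival d s := ival e s))\<rparr>) \<Longrightarrow> runs (ISet a d e) 1 s Q"
  unfolding runs_def using exec.ISet by blast

lemma runs_RSet:
  "Q (s\<lparr>reals := (reals s)(a := (reals s a)(ival d s := rval e s))\<rparr>) \<Longrightarrow> runs (RSet a d e) 1 s Q"
  unfolding runs_def using exec.RSet by blast

text \<open>The postcondition of \<open>c\<close> is itself a \<open>runs\<close> statement about
  \<open>d\<close>, so the assertion between the two programs is computed by the rules and need not
  be supplied.\<close>

lemma runs_Seq: "runs c T s (\<lambda>s'. runs d U s' Q) \<Longrightarrow> runs (Seq c d) (T + U) s Q"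
  unfolding runs_def by (meson add_mono exec.Seq)

lemma runs_Cond:
  assumes "bval b s \<Longrightarrow> runs c T s Q" and "\<not> bval b s \<Longrightarrow> runs d T s Q"
  shows "runs (Cond b c d) (T + 1) s Q"
proof (cases "bval b s")
  case True
  then obtain t s' where "exec c s t s'" "t \<le> T" "Q s'"
    using assms unfolding runs_def by blast
  with True show ?thesis
    unfolding runs_def using exec.CondTrue by (metis add_le_mono1)
next
  case False
  then obtain t s' where "exec d s t s'" "t \<le> T" "Q s'"
    using assms unfolding runs_def by blast
  with False show ?thesis
    unfolding runs_def using exec.CondFalse by (metis add_le_mono1)
qed

text \<open>The invariant is indexed by the number of completed rounds, which also decides the
  guard. Each round pays one step for its test, and the failing test pays the final one.\<close>

lemma runs_While:
  assumes init: "I 0 s"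
    and guard: "\<And>q s. I q s \<Longrightarrow> q \<le> N \<Longrightarrow> bval b s \<longleftrightarrow> q < N"
    and body: "\<And>q s. I q s \<Longrightarrow> q < N \<Longrightarrow> runs c T s (I (Suc q))"
  shows "runs (While b c) (N * (T + 1) + 1) s (I N)"
proof -
  have "runs (While b c) ((N - q) * (T + 1) + 1) s (I N)" if "I q s" "q \<le> N" for q s
    using that
  proof (induction "N - q" arbitrary: q s)
    case 0
    then have "q = N" by simp
    then show ?case
      using 0 guard[of q s] exec.WhileFalse[of b s c] unfolding runs_def by auto
  next
    case (Suc d)
    then have "q < N" by simp
    then obtain t s' where 1: "exec c s t s'" "t \<le> T" "I (Suc q) s'"
      using body Suc.prems unfolding runs_def by blast
    have "runs (While b c) ((N - Suc q) * (T + 1) + 1) s' (I N)"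
      using Suc 1 \<open>q < N\<close> by simp
    then obtain u s'' where 2: "exec (While b c) s' u s''"
      "u \<le> (N - Suc q) * (T + 1) + 1" "I N s''"
      unfolding runs_def by blast
    have "bval b s" using guard Suc.prems \<open>q < N\<close> by simp
    then have "exec (While b c) s (t + u + 1) s''"
      using 1 2 by (intro exec.WhileTrue)
    moreover have "N - q = Suc (N - Suc q)" using \<open>q < N\<close> by simp
    then have "t + u + 1 \<le> (N - q) * (T + 1) + 1"
      using 1(2) 2(2) by simp
    ultimately show ?case unfolding runs_def using 2(3) by blast
  qed
  from this[of 0 s] init show ?thesis by simp
qed

abbreviation ivar :: "vname \<Rightarrow> iexp" where
  "ivar v \<equiv> IGet v (IConst 0)"

definition For :: "vname \<Rightarrow> iexp \<Rightarrow> com \<Rightarrow> com" where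
  "For v e c = Seq (ISet v (IConst 0) (IConst 0))
     (While (ILess (ivar v) e) (Seq c (ISet v (IConst 0) (IAdd (ivar v) (IConst 1)))))"

abbreviation set_int :: "vname \<Rightarrow> nat \<Rightarrow> nat \<Rightarrow> memory \<Rightarrow> memory" where
  "set_int a i x s \<equiv> s\<lparr>ints := (ints s)(a := (ints s a)(i := x))\<rparr>"

abbreviation set_real :: "vname \<Rightarrow> nat \<Rightarrow> real \<Rightarrow> memory \<Rightarrow> memory" where
  "set_real a i x s \<equiv> s\<lparr>reals := (reals s)(a := (reals s a)(i := x))\<rparr>"

text \<open>The bound \<open>e\<close> is evaluated anew in every test and the body may write to any
  variable, so the invariant has to fix both the value of \<open>e\<close> and the counter. A round
  costs the body, a test and an increment; the reset and the last test give the final 2.\<close>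

lemma runs_For:
  assumes init: "I 0 (set_int v 0 0 s)"
    and bound: "\<And>q s. I q s \<Longrightarrow> q \<le> N \<Longrightarrow> ival e s = N"
    and var: "\<And>q s. I q s \<Longrightarrow> q \<le> N \<Longrightarrow> ints s v 0 = q"
    and body: "\<And>q s. I q s \<Longrightarrow> q < N \<Longrightarrow>
      runs c T s (\<lambda>s'. I (Suc q) (set_int v 0 (Suc (ints s' v 0)) s'))"
  shows "runs (For v e c) (N * (T + 2) + 2) s (I N)"
proof -
  have "runs (While (ILess (ivar v) e) (Seq c (ISet v (IConst 0) (IAdd (ivar v) (IConst 1)))))
      (N * ((T + 1) + 1) + 1) (set_int v 0 0 s) (I N)"
  proof (rule runs_While)
    fix q s assume *: "I q s" "q < N"
    show "runs (Seq c (ISet v (IConst 0) (IAdd (ivar v) (IConst 1)))) (T + 1) s (I (Suc q))"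
      by (rule runs_Seq, rule runs_weaken[OF body[OF *]], rule runs_ISet) simp
  qed (use init bound var in auto)
  then have "runs (For v e c) (1 + (N * ((T + 1) + 1) + 1)) s (I N)"
    unfolding For_def by (intro runs_Seq runs_ISet) simp
  then show ?thesis by (rule runs_mono) simp
qed

section \<open>The estimator as a program\<close>

text \<open>This is \<open>precedes s l j\<close> in De Morgan form, since the language has negation
  and conjunction only.\<close>

definition before_b :: bexp where
  "before_b = BNot (BAnd (BNot (RLess (RGet ''Y'' (ivar ''l'')) (RGet ''Y'' (ivar ''j''))))
     (BNot (BAnd (BNot (RLess (RGet ''Y'' (ivar ''j'')) (RGet ''Y'' (ivar ''l''))))
        (BNot (ILess (ivar ''j'') (ivar ''l''))))))"

definition incr :: "vname \<Rightarrow> iexp \<Rightarrow> com" where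
  "incr a e = ISet a e (IAdd (IGet a e) (IConst 1))"

definition ieq :: "iexp \<Rightarrow> iexp \<Rightarrow> bexp" where
  "ieq d e = BAnd (BNot (ILess d e)) (BNot (ILess e d))"

lemma bval_ieq [simp]: "bval (ieq d e) s \<longleftrightarrow> ival d s = ival e s"
  by (auto simp: ieq_def)

text \<open>The machine cannot round. For a bid in [0,1] the ceiling of n * Y is found as the number
  of l < n with l < n * Y, in the same loop that counts the rank.\<close>

definition count_prog :: com where
  "count_prog =
     For ''j'' (ivar ''n'') (Seq
       (For ''l'' (ivar ''n'') (Seq
         (Cond before_b (incr ''N'' (ivar ''j'')) Skip)
         (Cond (RLess (ROfInt (ivar ''l'')) (RMul (RGet ''Y'' (ivar ''j'')) (ROfInt (ivar ''n''))))
            (incr ''c'' (ivar ''j'')) Skip)))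
       (RSet ''b'' (ivar ''j'')
         (RDiv (ROfInt (IGet ''c'' (ivar ''j''))) (ROfInt (ivar ''n'')))))"

text \<open>For l = n the entry of \<open>N\<close> still has its initial value 0, so the same loop
  then multiplies over all ranks. The counter \<open>i\<close> starts at 0, whereas bidders start at
  1.\<close>

definition prod_prog :: com where
  "prod_prog =
     Seq (RSet ''p'' (IConst 0) (ROfInt (IConst 1)))
       (For ''j'' (ivar ''n'')
         (Cond (BAnd (ieq (IGet ''Z'' (ivar ''j'')) (IAdd (ivar ''i'') (IConst 1)))
                  (ILess (IGet ''N'' (ivar ''l'')) (IGet ''N'' (ivar ''j''))))
            (RSet ''p'' (IConst 0) (RMul (RGet ''p'' (IConst 0))
               (RSub (ROfInt (IConst 1))
                  (RDiv (ROfInt (IConst 1)) (ROfInt (IGet ''N'' (ivar ''j'')))))))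
            Skip))"

text \<open>Naturals cannot be multiplied, so the row-major index is kept as a running counter
  \<open>e\<close>. At l = n the array \<open>Z\<close> reads 0, which is no bidder, and the inner
  conditional stores the remaining mass.\<close>

definition weight_prog :: com where
  "weight_prog =
     For ''i'' (ivar ''k'') (For ''l'' (ivar ''m'') (Seq prod_prog (Seq
       (Cond (ieq (IGet ''Z'' (ivar ''l'')) (IAdd (ivar ''i'') (IConst 1)))
         (RSet ''w'' (ivar ''e'')
           (RDiv (RGet ''p'' (IConst 0)) (ROfInt (IGet ''N'' (ivar ''l'')))))
         (Cond (ILess (ivar ''l'') (ivar ''n'')) Skip
           (RSet ''w'' (ivar ''e'') (RGet ''p'' (IConst 0)))))
       (incr ''e'' (IConst 0)))))"

definition km_prog :: com where
  "km_prog = Seq count_prog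
     (Seq (ISet ''m'' (IConst 0) (IAdd (ivar ''n'') (IConst 1))) weight_prog)"

section \<open>The estimator as a function\<close>

text \<open>Lexicographic order by bid and index. It is linear even if bids coincide, so ranks are
  distinct without any assumption on the samples.\<close>

definition precedes :: "(nat \<Rightarrow> real \<times> nat) \<Rightarrow> nat \<Rightarrow> nat \<Rightarrow> bool" where
  "precedes s l j \<longleftrightarrow> fst (s l) < fst (s j) \<or> (\<not> fst (s j) < fst (s l) \<and> \<not> j < l)"

text \<open>As \<open>precedes\<close> is reflexive, ranks start at 1; without ties the rank is n
  times the empirical counterpart of \<open>H\<close> at the bid.\<close>

definition sample_rank :: "nat \<Rightarrow> (nat \<Rightarrow> real \<times> nat) \<Rightarrow> nat \<Rightarrow> nat" where
  "sample_rank n s j = card {l. l < n \<and> precedes s l j}"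

text \<open>The breakpoints are the bids rounded up to multiples of \<open>1 / n\<close>; see \<open>sets_km_est\<close> for the
  reason.\<close>

definition sample_cell :: "nat \<Rightarrow> (nat \<Rightarrow> real \<times> nat) \<Rightarrow> nat \<Rightarrow> nat" where
  "sample_cell n s j = card {q. q < n \<and> real q < fst (s j) * real n}"

definition rank_prod :: "nat \<Rightarrow> (nat \<Rightarrow> nat) \<Rightarrow> (nat \<Rightarrow> nat) \<Rightarrow> nat \<Rightarrow> nat \<Rightarrow> real" where
  "rank_prod n R Z i r = (\<Prod>j<n. if Z j = i \<and> r < R j then 1 - 1 / real (R j) else 1)"

text \<open>Index \<open>n\<close> belongs to an additional breakpoint at 0, which takes the remaining mass.\<close>

definition km_weight :: "nat \<Rightarrow> (nat \<Rightarrow> nat) \<Rightarrow> (nat \<Rightarrow> nat) \<Rightarrow> nat \<Rightarrow> nat \<Rightarrow> real" where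
  "km_weight n R Z i l =
     (if l < n then if Z l = i then rank_prod n R Z i (R l) / real (R l) else 0
      else rank_prod n R Z i 0)"

text \<open>Ranks, cells and winners are arguments in place of the samples: the estimate is thereby
  visibly a function of finitely many natural numbers.\<close>

definition km_fun :: "nat \<Rightarrow> (nat \<Rightarrow> nat) \<Rightarrow> (nat \<Rightarrow> nat) \<Rightarrow> (nat \<Rightarrow> nat) \<Rightarrow> nat \<Rightarrow> real \<Rightarrow> real" where
  "km_fun n R c Z i x =
     (\<Sum>l\<le>n. if (if l < n then real (c l) / real n else 0) \<le> x then km_weight n R Z i l else 0)"

definition km_est :: "nat \<Rightarrow> nat \<Rightarrow> (nat \<Rightarrow> real \<times> nat) \<Rightarrow> nat \<Rightarrow> real \<Rightarrow> real" where
  "km_est k n s i = km_fun n (sample_rank n s) (sample_cell n s) (\<lambda>j. snd (s j)) i"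

section \<open>Loop invariants and correctness of the program\<close>

text \<open>The value of \<open>Z\<close> is fixed beyond n as well, because the weight loop reads
  it at index n.\<close>

definition input_in :: "nat \<Rightarrow> nat \<Rightarrow> (nat \<Rightarrow> real \<times> nat) \<Rightarrow> memory \<Rightarrow> bool" where
  "input_in k n s u \<longleftrightarrow> ints u ''n'' 0 = n \<and> ints u ''k'' 0 = k \<and>
     (\<forall>j. ints u ''Z'' j = (if j < n then snd (s j) else 0)) \<and>
     (\<forall>j<n. reals u ''Y'' j = fst (s j))"

lemma card_Collect_less_Suc:
  "card {l. l < Suc q \<and> P l} = card {l. l < q \<and> P l} + (if P q then 1 else 0)"
proof -
  have "{l. l < Suc q \<and> P l} = {l. l < q \<and> P l} \<union> (if P q then {q} else {})"
    by (auto simp: less_Suc_eq)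
  then show ?thesis by simp
qed

text \<open>Entries not yet reached are asserted to be 0: the increments start from there, and the
  later phase reads \<open>N\<close> at index n and expects \<open>w\<close> and \<open>e\<close> to
  be untouched.\<close>

definition counted :: "nat \<Rightarrow> nat \<Rightarrow> (nat \<Rightarrow> real \<times> nat) \<Rightarrow> nat \<Rightarrow> memory \<Rightarrow> bool" where
  "counted k n s q u \<longleftrightarrow> input_in k n s u \<and>
     (\<forall>j. ints u ''N'' j = (if j < q then sample_rank n s j else 0)) \<and>
     (\<forall>j. ints u ''c'' j = (if j < q then sample_cell n s j else 0)) \<and>
     (\<forall>j. reals u ''b'' j = (if j < q then real (sample_cell n s j) / real n else 0)) \<and>
     reals u ''w'' = (\<lambda>_. 0) \<and> ints u ''e'' 0 = 0"

text \<open>Time bounds are left in the shape in which \<open>runs_For\<close> and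
  \<open>runs_Seq\<close> produce them, so that they unify; the arithmetic is done once, in
  \<open>km_prog_computes\<close>.\<close>

lemma runs_count_prog:
  assumes "counted k n s 0 u"
  shows "runs count_prog (n * ((n * (4 + 2) + 2 + 1) + 2) + 2) u (counted k n s n)"
proof -
  have "runs count_prog (n * ((n * (4 + 2) + 2 + 1) + 2) + 2) u
      (\<lambda>u. counted k n s n u \<and> ints u ''j'' 0 = n)"
    unfolding count_prog_def
  proof (rule runs_For[where I = "\<lambda>q u. counted k n s q u \<and> ints u ''j'' 0 = q"])
    show "counted k n s 0 (set_int ''j'' 0 0 u) \<and> ints (set_int ''j'' 0 0 u) ''j'' 0 = 0"
      using assms by (simp add: counted_def input_in_def)
  next
    fix q u
    assume q: "q < n" and "counted k n s q u \<and> ints u ''j'' 0 = q"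
    then have *: "counted k n s q u" "ints u ''j'' 0 = q" by auto
    \<comment> \<open>Entry q has been counted against the first p candidates only; all smaller
      entries are final.\<close>
    define I where "I p v \<longleftrightarrow> input_in k n s v \<and>
     (\<forall>j. ints v ''N'' j = (if j < q then sample_rank n s j else if j = q then
         card {l. l < p \<and> precedes s l j} else 0)) \<and>
     (\<forall>j. ints v ''c'' j = (if j < q then sample_cell n s j else if j = q then
         card {l. l < p \<and> real l < fst (s j) * real n} else 0)) \<and>
     (\<forall>j. reals v ''b'' j = (if j < q then real (sample_cell n s j) / real n else 0)) \<and>
     reals v ''w'' = (\<lambda>_. 0) \<and> ints v ''e'' 0 = 0 \<and> ints v ''j'' 0 = q \<and> ints v ''l'' 0 = p"
     for p v
    have I: "runs (For ''l'' (ivar ''n'') (Seq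
         (Cond before_b (incr ''N'' (ivar ''j'')) Skip)
         (Cond (RLess (ROfInt (ivar ''l'')) (RMul (RGet ''Y'' (ivar ''j'')) (ROfInt (ivar ''n''))))
            (incr ''c'' (ivar ''j'')) Skip))) (n * (4 + 2) + 2) u (I n)"
    proof (rule runs_For)
      show "I 0 (set_int ''l'' 0 0 u)"
        using * by (auto simp: I_def counted_def input_in_def)
    next
      fix p v assume p: "p < n" and v: "I p v"
      show "runs (Seq (Cond before_b (incr ''N'' (ivar ''j'')) Skip)
         (Cond (RLess (ROfInt (ivar ''l'')) (RMul (RGet ''Y'' (ivar ''j'')) (ROfInt (ivar ''n''))))
            (incr ''c'' (ivar ''j'')) Skip)) 4 v
            (\<lambda>v. I (Suc p) (set_int ''l'' 0 (Suc (ints v ''l'' 0)) v))"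
        unfolding incr_def
        apply (rule runs_mono)
         apply (rule runs_Seq)
         apply (rule runs_Cond)
          apply (rule runs_ISet)
          apply (rule runs_Cond)
           apply (rule runs_ISet)
           prefer 2
           apply (rule runs_Skip)
          prefer 3
          apply (rule runs_Skip)
          apply (rule runs_Cond)
           apply (rule runs_ISet)
           prefer 2
           apply (rule runs_Skip)
        using v p q
        by (simp_all add: I_def input_in_def before_b_def card_Collect_less_Suc precedes_def)
    qed (auto simp: I_def input_in_def)
    show "runs (Seq (For ''l'' (ivar ''n'') (Seq
         (Cond before_b (incr ''N'' (ivar ''j'')) Skip)
         (Cond (RLess (ROfInt (ivar ''l'')) (RMul (RGet ''Y'' (ivar ''j'')) (ROfInt (ivar ''n''))))
            (incr ''c'' (ivar ''j'')) Skip)))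
       (RSet ''b'' (ivar ''j'')
         (RDiv (ROfInt (IGet ''c'' (ivar ''j''))) (ROfInt (ivar ''n''))))) (n * (4 + 2) + 2 + 1) u
         (\<lambda>u. counted k n s (Suc q) (set_int ''j'' 0 (Suc (ints u ''j'' 0)) u) \<and>
            ints (set_int ''j'' 0 (Suc (ints u ''j'' 0)) u) ''j'' 0 = Suc q)"
      apply (rule runs_Seq)
      apply (rule runs_weaken[OF I])
      apply (rule runs_RSet)
      using q by (auto simp: I_def counted_def input_in_def sample_rank_def sample_cell_def less_Suc_eq)
  qed (auto simp: counted_def input_in_def)
  then show ?thesis by (rule runs_weaken) simp
qed

text \<open>There are q complete rows and p entries of the next one. Everything from
  \<open>e\<close> on is 0, which lets the program skip the writing of zero weights.\<close>

definition weighted :: "nat \<Rightarrow> nat \<Rightarrow> (nat \<Rightarrow> real \<times> nat) \<Rightarrow> nat \<Rightarrow> nat \<Rightarrow> memory \<Rightarrow> bool" where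
  "weighted k n s q p u \<longleftrightarrow> input_in k n s u \<and> ints u ''m'' 0 = n + 1 \<and>
     (\<forall>j. ints u ''N'' j = (if j < n then sample_rank n s j else 0)) \<and>
     (\<forall>j. reals u ''b'' j = (if j < n then real (sample_cell n s j) / real n else 0)) \<and>
     (\<forall>i l. (i < q \<and> l \<le> n \<or> i = q \<and> l < p) \<longrightarrow> reals u ''w'' (i * (n + 1) + l) =
        km_weight n (sample_rank n s) (\<lambda>j. snd (s j)) (i + 1) l) \<and>
     ints u ''e'' 0 = q * (n + 1) + p \<and> (\<forall>j\<ge>ints u ''e'' 0. reals u ''w'' j = 0)"

lemma runs_prod_prog:
  assumes "weighted k n s q p u" "ints u ''i'' 0 = q" "ints u ''l'' 0 = p" "p \<le> n"
  shows "runs prod_prog (1 + (n * (2 + 2) + 2)) u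
    (\<lambda>u. weighted k n s q p u \<and> ints u ''i'' 0 = q \<and> ints u ''l'' 0 = p \<and>
       reals u ''p'' 0 = rank_prod n (sample_rank n s) (\<lambda>j. snd (s j)) (q + 1)
         (if p < n then sample_rank n s p else 0))"
  unfolding prod_prog_def
proof (rule runs_Seq, rule runs_RSet)
  define I where "I r v \<longleftrightarrow> weighted k n s q p v \<and> ints v ''i'' 0 = q \<and> ints v ''l'' 0 = p \<and>
    ints v ''j'' 0 = r \<and>
    reals v ''p'' 0 = (\<Prod>j<r. if snd (s j) = q + 1 \<and> (if p < n then sample_rank n s p else 0) < sample_rank n s j
       then 1 - 1 / real (sample_rank n s j) else 1)" for r v
  let ?u = "set_real ''p'' (ival (IConst 0) u) (rval (ROfInt (IConst 1)) u) u"
  have "runs (For ''j'' (ivar ''n'')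
         (Cond (BAnd (ieq (IGet ''Z'' (ivar ''j'')) (IAdd (ivar ''i'') (IConst 1)))
                  (ILess (IGet ''N'' (ivar ''l'')) (IGet ''N'' (ivar ''j''))))
            (RSet ''p'' (IConst 0) (RMul (RGet ''p'' (IConst 0))
               (RSub (ROfInt (IConst 1))
                  (RDiv (ROfInt (IConst 1)) (ROfInt (IGet ''N'' (ivar ''j'')))))))
            Skip)) (n * (2 + 2) + 2) ?u (I n)"
  proof (rule runs_For)
    show "I 0 (set_int ''j'' 0 0 ?u)"
      using assms by (simp add: I_def weighted_def input_in_def)
  next
    fix r v assume r: "r < n" and v: "I r v"
    show "runs (Cond (BAnd (ieq (IGet ''Z'' (ivar ''j'')) (IAdd (ivar ''i'') (IConst 1)))
                  (ILess (IGet ''N'' (ivar ''l'')) (IGet ''N'' (ivar ''j''))))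
            (RSet ''p'' (IConst 0) (RMul (RGet ''p'' (IConst 0))
               (RSub (ROfInt (IConst 1))
                  (RDiv (ROfInt (IConst 1)) (ROfInt (IGet ''N'' (ivar ''j'')))))))
            Skip) 2 v (\<lambda>v. I (Suc r) (set_int ''j'' 0 (Suc (ints v ''j'' 0)) v))"
      apply (rule runs_mono)
       apply (rule runs_Cond)
        apply (rule runs_RSet)
        prefer 2
        apply (rule runs_Skip)
      using v r
      by (auto simp: I_def weighted_def input_in_def)
  qed (auto simp: I_def weighted_def input_in_def)
  then show "runs (For ''j'' (ivar ''n'')
         (Cond (BAnd (ieq (IGet ''Z'' (ivar ''j'')) (IAdd (ivar ''i'') (IConst 1)))
                  (ILess (IGet ''N'' (ivar ''l'')) (IGet ''N'' (ivar ''j''))))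
            (RSet ''p'' (IConst 0) (RMul (RGet ''p'' (IConst 0))
               (RSub (ROfInt (IConst 1))
                  (RDiv (ROfInt (IConst 1)) (ROfInt (IGet ''N'' (ivar ''j'')))))))
            Skip)) (n * (2 + 2) + 2) ?u
    (\<lambda>u. weighted k n s q p u \<and> ints u ''i'' 0 = q \<and> ints u ''l'' 0 = p \<and>
       reals u ''p'' 0 = rank_prod n (sample_rank n s) (\<lambda>j. snd (s j)) (q + 1)
         (if p < n then sample_rank n s p else 0))"
    by (rule runs_weaken) (simp add: I_def rank_prod_def)
qed

lemma weighted_set_counter:
  "weighted k n s q p (set_int ''l'' 0 x u) \<longleftrightarrow> weighted k n s q p u"
  unfolding weighted_def input_in_def by simp

lemma weighted_Suc:
  assumes u: "weighted k n s q p u" and p: "p \<le> n"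
    and x: "reals u ''p'' 0 = rank_prod n (sample_rank n s) (\<lambda>j. snd (s j)) (q + 1)
         (if p < n then sample_rank n s p else 0)"
    and v: "ints v = (ints u)(''e'' := (ints u ''e'')(0 := Suc (ints u ''e'' 0)))"
      "reals v = (reals u)(''w'' := (reals u ''w'')(ints u ''e'' 0 :=
         km_weight n (sample_rank n s) (\<lambda>j. snd (s j)) (q + 1) p))"
  shows "weighted k n s q (Suc p) v"
proof -
  define idx where "idx i l = i * (n + 1) + l" for i l
  \<comment> \<open>Row i ends before row q begins, so the new write does not hit an earlier
    entry.\<close>
  have ne: "idx i l \<noteq> idx q p" if "i < q \<and> l \<le> n \<or> i = q \<and> l < p" for i l
  proof (cases "i < q")
    case True
    then have "(i + 1) * (n + 1) \<le> q * (n + 1)" by (intro mult_right_mono) auto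
    then show ?thesis using that True by (auto simp: idx_def)
  qed (use that in \<open>auto simp: idx_def\<close>)
  have e: "ints u ''e'' 0 = idx q p" and Suc: "idx q (Suc p) = Suc (idx q p)"
    using u by (auto simp: weighted_def idx_def)
  have w: "reals u ''w'' (idx i l) = km_weight n (sample_rank n s) (\<lambda>j. snd (s j)) (i + 1) l"
    if "i < q \<and> l \<le> n \<or> i = q \<and> l < p" for i l
    using u that unfolding weighted_def idx_def by blast
  have "reals v ''w'' (idx i l) = km_weight n (sample_rank n s) (\<lambda>j. snd (s j)) (i + 1) l"
    if "i < q \<and> l \<le> n \<or> i = q \<and> l < Suc p" for i l
  proof (cases "i = q \<and> l = p")
    case False
    then have "i < q \<and> l \<le> n \<or> i = q \<and> l < p" using that by auto
    then show ?thesis using w ne v e by simp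
  qed (simp add: v e)
  moreover have "ints v ''e'' 0 = idx q (Suc p)"
    using v e Suc by simp
  moreover have "\<forall>j\<ge>ints v ''e'' 0. reals v ''w'' j = 0"
    using u v by (auto simp: weighted_def)
  ultimately show ?thesis
    using u v unfolding weighted_def input_in_def idx_def by simp
qed

lemma weighted_row:
  assumes "weighted k n s q (n + 1) u"
  shows "weighted k n s (Suc q) 0 (set_int ''i'' 0 x u)"
proof -
  have a: "input_in k n s u" "ints u ''m'' 0 = n + 1"
     "\<forall>j. ints u ''N'' j = (if j < n then sample_rank n s j else 0)"
     "\<forall>j. reals u ''b'' j = (if j < n then real (sample_cell n s j) / real n else 0)"
    and w: "\<And>i l. (i < q \<and> l \<le> n \<or> i = q \<and> l < n + 1) \<Longrightarrow> reals u ''w'' (i * (n + 1) + l) =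
        km_weight n (sample_rank n s) (\<lambda>j. snd (s j)) (i + 1) l"
    and e: "ints u ''e'' 0 = q * (n + 1) + (n + 1)" "\<forall>j\<ge>ints u ''e'' 0. reals u ''w'' j = 0"
    using assms unfolding weighted_def by blast+
  have "weighted k n s (Suc q) 0 u"
    unfolding weighted_def
  proof (intro conjI allI impI)
    fix i l :: nat
    assume "i < Suc q \<and> l \<le> n \<or> i = Suc q \<and> l < 0"
    then show "reals u ''w'' (i * (n + 1) + l) =
        km_weight n (sample_rank n s) (\<lambda>j. snd (s j)) (i + 1) l"
      by (intro w) auto
  qed (use a e in auto)
  then show ?thesis unfolding weighted_def input_in_def by simp
qed

lemma runs_weight_prog:
  assumes "weighted k n s 0 0 u"
  shows "runs weight_prog
    (k * (((n + 1) * ((1 + (n * (2 + 2) + 2) + 4) + 2) + 2) + 2) + 2) u (weighted k n s k 0)"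
proof -
  have "runs weight_prog
    (k * (((n + 1) * ((1 + (n * (2 + 2) + 2) + 4) + 2) + 2) + 2) + 2) u
    (\<lambda>u. weighted k n s k 0 u \<and> ints u ''i'' 0 = k)"
    unfolding weight_prog_def
  proof (rule runs_For[where I = "\<lambda>q u. weighted k n s q 0 u \<and> ints u ''i'' 0 = q"])
    show "weighted k n s 0 0 (set_int ''i'' 0 0 u) \<and> ints (set_int ''i'' 0 0 u) ''i'' 0 = 0"
      using assms by (simp add: weighted_def input_in_def)
  next
    fix q u assume "weighted k n s q 0 u \<and> ints u ''i'' 0 = q"
    then have *: "weighted k n s q 0 u" "ints u ''i'' 0 = q" by auto
    let ?rest = "Seq
       (Cond (ieq (IGet ''Z'' (ivar ''l'')) (IAdd (ivar ''i'') (IConst 1)))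
         (RSet ''w'' (ivar ''e'')
           (RDiv (RGet ''p'' (IConst 0)) (ROfInt (IGet ''N'' (ivar ''l'')))))
         (Cond (ILess (ivar ''l'') (ivar ''n'')) Skip
           (RSet ''w'' (ivar ''e'') (RGet ''p'' (IConst 0)))))
       (incr ''e'' (IConst 0))"
    have "runs (For ''l'' (ivar ''m'') (Seq prod_prog ?rest))
        ((n + 1) * ((1 + (n * (2 + 2) + 2) + 4) + 2) + 2) u
        (\<lambda>u. weighted k n s q (n + 1) u \<and> ints u ''i'' 0 = q \<and> ints u ''l'' 0 = n + 1)"
    proof (rule runs_For[where I = "\<lambda>p u. weighted k n s q p u \<and> ints u ''i'' 0 = q \<and>
          ints u ''l'' 0 = p"])
      show "weighted k n s q 0 (set_int ''l'' 0 0 u) \<and> ints (set_int ''l'' 0 0 u) ''i'' 0 = q \<and>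
        ints (set_int ''l'' 0 0 u) ''l'' 0 = 0"
        using * by (simp add: weighted_def input_in_def)
    next
      fix p u
      assume p: "p < n + 1"
        and "weighted k n s q p u \<and> ints u ''i'' 0 = q \<and> ints u ''l'' 0 = p"
      then have *: "weighted k n s q p u" "ints u ''i'' 0 = q" "ints u ''l'' 0 = p" "p \<le> n"
        by auto
      let ?R = "\<lambda>v. weighted k n s q (Suc p) v \<and> ints v ''i'' 0 = q \<and> ints v ''l'' 0 = Suc p"
      have "runs ?rest 4 v (\<lambda>v. ?R (set_int ''l'' 0 (Suc (ints v ''l'' 0)) v))"
        if v: "weighted k n s q p v" "ints v ''i'' 0 = q" "ints v ''l'' 0 = p"
         "reals v ''p'' 0 = rank_prod n (sample_rank n s) (\<lambda>j. snd (s j)) (q + 1)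
           (if p < n then sample_rank n s p else 0)" for v
      proof -
        define x where "x = km_weight n (sample_rank n s) (\<lambda>j. snd (s j)) (q + 1) p"
        have 1: "weighted k n s q (Suc p) (set_int ''e'' 0 (Suc (ints v ''e'' 0))
            (set_real ''w'' (ints v ''e'' 0) x v))"
          by (rule weighted_Suc[OF v(1) \<open>p \<le> n\<close> v(4)]) (simp_all add: x_def)
        have 2: "weighted k n s q (Suc p) (set_int ''l'' 0 (Suc p)
            (set_int ''e'' 0 (Suc (ints v ''e'' 0)) (set_real ''w'' (ints v ''e'' 0) x v)))"
          using 1 unfolding weighted_set_counter .
        \<comment> \<open>A skipped write agrees with writing 0, since the entry at \<open>e\<close>
          has not been touched yet.\<close>
        have w0: "x = 0 \<Longrightarrow> (reals v)(''w'' := (reals v ''w'')(ints v ''e'' 0 := x)) = reals v"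
          using v(1) unfolding weighted_def by (auto simp: fun_eq_iff)
        have Z: "ints v ''Z'' p = (if p < n then snd (s p) else 0)"
          and n: "ints v ''n'' 0 = n"
          and N: "ints v ''N'' p = (if p < n then sample_rank n s p else 0)"
          using v(1) unfolding weighted_def input_in_def by auto
        \<comment> \<open>The case distinction of the program. At p = n it takes the last branch, as
          \<open>Z\<close> is 0 there and q + 1 is not.\<close>
        have x: "x = (if ints v ''Z'' p = q + 1 then reals v ''p'' 0 / real (ints v ''N'' p)
            else if p < n then 0 else reals v ''p'' 0)"
          unfolding x_def km_weight_def Z N v(4) by simp
        show ?thesis
          unfolding incr_def
          apply (rule runs_mono)
           apply (rule runs_Seq)
           apply (rule runs_Cond)
            \<comment> \<open>The plain assignment is given the larger bound of the nested
              conditional, since the branches share one bound.\<close>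
            apply (rule runs_mono[OF runs_RSet[OF runs_ISet]])
             prefer 2
             apply (rule le_add2)
            prefer 2
            apply (rule runs_Cond)
             apply (rule runs_Skip)
             apply (rule runs_ISet)
             prefer 2
             apply (rule runs_RSet)
             apply (rule runs_ISet)
          using 2 v(2,3) Z n N x w0
          by simp_all
      qed
      then show "runs (Seq prod_prog ?rest) (1 + (n * (2 + 2) + 2) + 4) u
         (\<lambda>v. ?R (set_int ''l'' 0 (Suc (ints v ''l'' 0)) v))"
        by (intro runs_Seq runs_weaken[OF runs_prod_prog[OF *]]) blast
    qed (auto simp: weighted_def input_in_def)
    then show "runs (For ''l'' (ivar ''m'') (Seq prod_prog ?rest))
        ((n + 1) * ((1 + (n * (2 + 2) + 2) + 4) + 2) + 2) u
        (\<lambda>u. weighted k n s (Suc q) 0 (set_int ''i'' 0 (Suc (ints u ''i'' 0)) u) \<and>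
          ints (set_int ''i'' 0 (Suc (ints u ''i'' 0)) u) ''i'' 0 = Suc q)"
      by (rule runs_weaken) (simp add: weighted_row)
  qed (auto simp: weighted_def input_in_def)
  then show ?thesis by (rule runs_weaken) simp
qed

lemma runs_km_prog:
  "runs km_prog (n * ((n * (4 + 2) + 2 + 1) + 2) + 2 +
     (1 + (k * (((n + 1) * ((1 + (n * (2 + 2) + 2) + 4) + 2) + 2) + 2) + 2)))
     (input_memory k n s) (weighted k n s k 0)"
  unfolding km_prog_def
proof (rule runs_Seq)
  let ?T = "k * (((n + 1) * ((1 + (n * (2 + 2) + 2) + 4) + 2) + 2) + 2) + 2"
  have "counted k n s 0 (input_memory k n s)"
    by (simp add: counted_def input_in_def input_memory_def)
  note runs_count_prog[OF this]
  moreover have "runs (Seq (ISet ''m'' (IConst 0) (IAdd (ivar ''n'') (IConst 1))) weight_prog)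
      (1 + ?T) u (weighted k n s k 0)" if "counted k n s n u" for u
    using that by (intro runs_Seq runs_ISet runs_weight_prog)
      (auto simp: counted_def weighted_def input_in_def)
  ultimately show "runs count_prog (n * ((n * (4 + 2) + 2 + 1) + 2) + 2) (input_memory k n s)
    (\<lambda>u. runs (Seq (ISet ''m'' (IConst 0) (IAdd (ivar ''n'') (IConst 1))) weight_prog)
      (1 + ?T) u (weighted k n s k 0))"
    by (rule runs_weaken)
qed

lemma output_function_weighted:
  assumes "weighted k n s k 0 u" "i \<in> {1..k}"
  shows "output_function u i = km_est k n s i"
proof
  fix x
  have i: "i - 1 < k" "i - 1 + 1 = i" using assms(2) by auto
  have "reals u ''w'' ((i - 1) * (n + 1) + l) = km_weight n (sample_rank n s) (\<lambda>j. snd (s j)) i l"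
    if "l \<le> n" for l
    using assms(1) i that unfolding weighted_def by metis
  moreover have "reals u ''b'' l = (if l < n then real (sample_cell n s l) / real n else 0)" for l
    using assms(1) unfolding weighted_def by simp
  moreover have "ints u ''m'' 0 = n + 1"
    using assms(1) unfolding weighted_def by simp
  ultimately show "output_function u i x = km_est k n s i x"
    unfolding output_function_def km_est_def km_fun_def Let_def
    by (intro sum.cong) auto
qed

lemma km_prog_computes: "computes_in_poly_time km_prog km_est"
  unfolding computes_in_poly_time_def
\<comment> \<open>The polynomial is the total bound with k replaced by n.\<close>
proof (rule exI[of _ "[:5, 18, 19, 4:]"], intro allI)
  fix k n :: nat and s :: "nat \<Rightarrow> real \<times> nat"
  define T where "T = n * ((n * (4 + 2) + 2 + 1) + 2) + 2 +
     (1 + (k * (((n + 1) * ((1 + (n * (2 + 2) + 2) + 4) + 2) + 2) + 2) + 2))"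
  obtain t u where *: "exec km_prog (input_memory k n s) t u" "t \<le> T" "weighted k n s k 0 u"
    using runs_km_prog[of n k s] unfolding runs_def T_def by blast
  have "t \<le> poly [:5, 18, 19, 4:] n" if "k \<le> n"
  proof -
    have "k * (((n + 1) * ((1 + (n * (2 + 2) + 2) + 4) + 2) + 2) + 2) \<le>
        n * (((n + 1) * ((1 + (n * (2 + 2) + 2) + 4) + 2) + 2) + 2)"
      using that by (rule mult_right_mono) simp
    then have "T \<le> poly [:5, 18, 19, 4:] n"
      unfolding T_def by (simp add: algebra_simps)
    then show ?thesis using *(2) by simp
  qed
  then show "\<exists>t s'. exec km_prog (input_memory k n s) t s' \<and> (k \<le> n \<longrightarrow> t \<le> poly [:5, 18, 19, 4:] n) \<and>
      (\<forall>i\<in>{1..k}. km_est k n s i = output_function s' i)"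
    using * output_function_weighted by metis
qed

section \<open>The product estimator\<close>

text \<open>The factors (l - 1) / l increase with l. With m factors the product is smallest on the
  ranks r + 1, ..., r + m, where it telescopes to r / (r + m), and largest on the last m ranks,
  where it is (r' - m) / r'. The upper bound is multiplied out so that r' = 0 is allowed.\<close>

lemma km_ratio_bounds:
  fixes S :: "nat set" and r r' :: nat
  assumes "r \<le> r'"
  defines "m \<equiv> card (S \<inter> {r<..r'})"
  defines "P \<equiv> (\<Prod>l\<in>S \<inter> {r<..r'}. 1 - 1 / real l)"
  shows "m \<le> r' - r" "real r / (real r + real m) \<le> P" "0 \<le> P" "P \<le> 1" "P * real r' \<le> real r' - real m"
proof -
  have "card (S \<inter> {r<..r'}) \<le> r' - r \<and> 
     real r / (real r + real (card (S \<inter> {r<..r'}))) \<le> (\<Prod>l\<in>S \<inter> {r<..r'}. 1 - 1 / real l) \<and>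
     0 \<le> (\<Prod>l\<in>S \<inter> {r<..r'}. 1 - 1 / real l) \<and>
     (\<Prod>l\<in>S \<inter> {r<..r'}. 1 - 1 / real l) * real r' \<le> real r' - real (card (S \<inter> {r<..r'}))"
    using assms(1)
  proof (induction r' rule: dec_induct)
    case base
    then show ?case by simp
  next
    case (step b)
    let ?A = "S \<inter> {r<..b}"
    let ?p = "\<Prod>l\<in>?A. 1 - 1 / real l"
    have fin: "finite ?A" by simp
    show ?case
    proof (cases "Suc b \<in> S")
      case False
      then have "S \<inter> {r<..Suc b} = ?A" using le_Suc_eq by auto
      moreover have "?p \<le> 1" by (rule prod_le_1) auto
      ultimately show ?thesis using step.IH step.hyps by (auto simp: algebra_simps)
    next
      case True
      then have A: "S \<inter> {r<..Suc b} = insert (Suc b) ?A" using le_Suc_eq step.hyps by auto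
      have c: "card (S \<inter> {r<..Suc b}) = Suc (card ?A)" unfolding A using fin by simp
      have p: "(\<Prod>l\<in>S \<inter> {r<..Suc b}. 1 - 1 / real l) = ?p * (real b / real (Suc b))"
        unfolding A using fin by (simp add: field_simps)
      let ?m = "card ?A"
      have IH: "?m \<le> b - r" "real r / (real r + real ?m) \<le> ?p" "0 \<le> ?p" "?p * real b \<le> real b - real ?m"
        using step.IH by auto
      have "real r / (real r + real (Suc ?m)) \<le> ?p * (real b / real (Suc b))"
      proof (cases "r = 0")
        case False
        have gen: "a / (c + 1) = a / c * (c / (c + 1))" if "c \<noteq> 0" for a c :: real
          using that by simp
        have "real r / (real r + real (Suc ?m)) =
            real r / (real r + real ?m) * ((real r + real ?m) / (real r + real ?m + 1))"
          using False gen[of "real r + real ?m" "real r"] by (simp add: add.assoc add.commute)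
        also have "\<dots> \<le> ?p * (real b / real (Suc b))"
        proof (rule mult_mono)
          \<comment> \<open>Monotonicity of c / (c + 1): the new factor is at least the one that the
            extremal product would gain.\<close>
          have "real r + real ?m \<le> real b" using IH(1) step.hyps by linarith
          then show "(real r + real ?m) / (real r + real ?m + 1) \<le> real b / real (Suc b)"
            by (simp add: field_simps)
        qed (use IH in auto)
        finally show ?thesis .
      qed (use IH in auto)
      moreover have "?p * (real b / real (Suc b)) * real (Suc b) = ?p * real b" by simp
      ultimately show ?thesis unfolding p c using IH step.hyps by auto
    qed
  qed
  then show "m \<le> r' - r" "real r / (real r + real m) \<le> P" "0 \<le> P" "P * real r' \<le> real r' - real m"
    by (auto simp: m_def P_def)
  show "P \<le> 1" unfolding P_def by (rule prod_le_1) (auto simp: field_simps)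
qed

text \<open>For l in \<open>S\<close> one has G (l - 1) = (1 - 1 / l) * G l, so G jumps by G l / l
  at l and nowhere else. The jump heights of the product are thus explicit, and \<open>G 0\<close>
  is the mass left over.\<close>

lemma km_telescope:
  fixes S :: "nat set"
  assumes "finite S"
  defines "G \<equiv> \<lambda>r. \<Prod>l\<in>S \<inter> {r<..}. 1 - 1 / real l"
  shows "G 0 + (\<Sum>l\<in>S \<inter> {0<..r}. G l / real l) = G r"
proof (induction r)
  case (Suc r)
  show ?case
  proof (cases "Suc r \<in> S")
    case False
    then have "S \<inter> {r<..} = S \<inter> {Suc r<..}" "S \<inter> {0<..Suc r} = S \<inter> {0<..r}"
      by (auto simp: le_Suc_eq) (metis Suc_lessI)
    then show ?thesis using Suc by (simp add: G_def)
  next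
    case True
    then have A: "S \<inter> {r<..} = insert (Suc r) (S \<inter> {Suc r<..})"
      and B: "S \<inter> {0<..Suc r} = insert (Suc r) (S \<inter> {0<..r})"
      by (auto simp: le_Suc_eq)
    have G: "G r = (1 - 1 / real (Suc r)) * G (Suc r)"
      unfolding G_def A using assms(1) by simp
    have "(\<Sum>l\<in>S \<inter> {0<..Suc r}. G l / real l) =
        G (Suc r) / real (Suc r) + (\<Sum>l\<in>S \<inter> {0<..r}. G l / real l)"
      unfolding B using assms(1) by simp
    then show ?thesis using Suc G by (simp add: algebra_simps)
  qed
qed simp

section \<open>Ranks, empirical counts and the unrounded estimator\<close>

lemma precedes_trans: "precedes s a b \<Longrightarrow> precedes s b c \<Longrightarrow> precedes s a c"
  unfolding precedes_def by auto

lemma precedes_total: "precedes s a b \<or> precedes s b a"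
  unfolding precedes_def by auto

lemma precedes_antisym: "precedes s a b \<Longrightarrow> precedes s b a \<Longrightarrow> a = b"
  unfolding precedes_def by auto

lemma precedes_refl: "precedes s a a"
  unfolding precedes_def by auto

lemma sample_rank_less:
  assumes "b < n" "precedes s a b" "a \<noteq> b"
  shows "sample_rank n s a < sample_rank n s b"
  unfolding sample_rank_def
proof (rule psubset_card_mono)
  have "b \<notin> {l. l < n \<and> precedes s l a}"
    using assms precedes_antisym by auto
  then show "{l. l < n \<and> precedes s l a} \<subset> {l. l < n \<and> precedes s l b}"
    using assms precedes_refl precedes_trans by blast
qed simp

lemma inj_sample_rank: "inj_on (sample_rank n s) {..<n}"
  by (rule inj_onI) (metis lessThan_iff less_irrefl precedes_total sample_rank_less)

definition count_le :: "nat \<Rightarrow> (nat \<Rightarrow> real \<times> nat) \<Rightarrow> real \<Rightarrow> nat" where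
  "count_le n s x = card {j. j < n \<and> fst (s j) \<le> x}"

text \<open>The samples with bid at most x are an initial segment of the order, so they occupy
  exactly the ranks up to \<open>count_le n s x\<close>. This translates between bids and
  ranks.\<close>

lemma sample_rank_le_iff:
  assumes "j < n"
  shows "sample_rank n s j \<le> count_le n s x \<longleftrightarrow> fst (s j) \<le> x"
proof
  assume "fst (s j) \<le> x"
  then show "sample_rank n s j \<le> count_le n s x"
    unfolding sample_rank_def count_le_def by (intro card_mono) (auto simp: precedes_def)
next
  assume *: "sample_rank n s j \<le> count_le n s x"
  show "fst (s j) \<le> x"
  proof (rule ccontr)
    assume "\<not> fst (s j) \<le> x"
    then have "{l. l < n \<and> fst (s l) \<le> x} \<subset> {l. l < n \<and> precedes s l j}"
      using assms precedes_refl[of s j] by (auto simp: precedes_def)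
    then have "count_le n s x < sample_rank n s j"
      unfolding sample_rank_def count_le_def by (intro psubset_card_mono) auto
    then show False using * by simp
  qed
qed

lemma sample_rank_pos: "j < n \<Longrightarrow> 0 < sample_rank n s j"
  unfolding sample_rank_def using precedes_refl by (auto simp: card_gt_0_iff)

definition ranks_of :: "nat \<Rightarrow> (nat \<Rightarrow> real \<times> nat) \<Rightarrow> nat \<Rightarrow> nat set" where
  "ranks_of n s i = sample_rank n s ` {j. j < n \<and> snd (s j) = i}"

text \<open>The Kaplan--Meier product before rounding of the breakpoints. The analysis is carried
  out for it; \<open>km_est\<close> is only compared with it.\<close>

definition km_cdf :: "nat \<Rightarrow> (nat \<Rightarrow> real \<times> nat) \<Rightarrow> nat \<Rightarrow> real \<Rightarrow> real" where
  "km_cdf n s i x = (\<Prod>l\<in>ranks_of n s i \<inter> {count_le n s x<..}. 1 - 1 / real l)"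

lemma finite_ranks_of: "finite (ranks_of n s i)"
  unfolding ranks_of_def by simp

lemma rank_prod_eq:
  "rank_prod n (sample_rank n s) (\<lambda>j. snd (s j)) i r =
     (\<Prod>l\<in>ranks_of n s i \<inter> {r<..}. 1 - 1 / real l)"
proof -
  let ?J = "{j. j < n \<and> snd (s j) = i \<and> r < sample_rank n s j}"
  have "rank_prod n (sample_rank n s) (\<lambda>j. snd (s j)) i r =
      (\<Prod>j\<in>?J. 1 - 1 / real (sample_rank n s j))"
    unfolding rank_prod_def by (subst prod.inter_filter[symmetric]) (auto intro!: prod.cong)
  also have "\<dots> = (\<Prod>l\<in>sample_rank n s ` ?J. 1 - 1 / real l)"
    by (subst prod.reindex) (auto intro: inj_on_subset[OF inj_sample_rank])
  also have "sample_rank n s ` ?J = ranks_of n s i \<inter> {r<..}"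
    unfolding ranks_of_def by auto
  finally show ?thesis .
qed

lemma rank_prod_nonneg: "0 \<le> rank_prod n (sample_rank n s) (\<lambda>j. snd (s j)) i r"
  unfolding rank_prod_eq by (rule prod_nonneg) (auto simp: field_simps)

lemma km_weight_nonneg: "0 \<le> km_weight n (sample_rank n s) (\<lambda>j. snd (s j)) i l"
  unfolding km_weight_def by (simp add: rank_prod_nonneg)

text \<open>Reindexing by ranks turns the sum of weights into the telescoping sum of
  \<open>km_telescope\<close>. The condition on x makes the extra breakpoint at 0 count.\<close>

lemma km_weight_sum:
  assumes "0 \<le> x"
  shows "(\<Sum>l\<le>n. if (if l < n then fst (s l) else 0) \<le> x
     then km_weight n (sample_rank n s) (\<lambda>j. snd (s j)) i l else 0) = km_cdf n s i x"
proof -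
  let ?G = "\<lambda>r. \<Prod>l\<in>ranks_of n s i \<inter> {r<..}. 1 - 1 / real l"
  let ?J = "{l. l < n \<and> snd (s l) = i \<and> fst (s l) \<le> x}"
  have "(\<Sum>l\<le>n. if (if l < n then fst (s l) else 0) \<le> x
     then km_weight n (sample_rank n s) (\<lambda>j. snd (s j)) i l else 0) =
     ?G 0 + (\<Sum>l<n. if fst (s l) \<le> x
     then km_weight n (sample_rank n s) (\<lambda>j. snd (s j)) i l else 0)"
    unfolding atMost_Suc lessThan_Suc_atMost[symmetric] using assms
    by (simp add: km_weight_def rank_prod_eq)
  also have "(\<Sum>l<n. if fst (s l) \<le> x
     then km_weight n (sample_rank n s) (\<lambda>j. snd (s j)) i l else 0) =
     (\<Sum>l\<in>?J. ?G (sample_rank n s l) / real (sample_rank n s l))"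
    by (rule sum.mono_neutral_cong_right) (auto simp: km_weight_def rank_prod_eq)
  also have "\<dots> = (\<Sum>r\<in>sample_rank n s ` ?J. ?G r / real r)"
    by (subst sum.reindex) (auto intro: inj_on_subset[OF inj_sample_rank])
  also have "sample_rank n s ` ?J = ranks_of n s i \<inter> {0<..count_le n s x}"
    unfolding ranks_of_def using sample_rank_le_iff sample_rank_pos by auto
  finally show ?thesis
    using km_telescope[OF finite_ranks_of] unfolding km_cdf_def by simp
qed

lemma card_ranks_between:
  assumes "x \<le> y"
  shows "card (ranks_of n s i \<inter> {count_le n s x<..count_le n s y}) =
    card {j. j < n \<and> x < fst (s j) \<and> fst (s j) \<le> y \<and> snd (s j) = i}"
proof -
  have "ranks_of n s i \<inter> {count_le n s x<..count_le n s y} =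
    sample_rank n s ` {j. j < n \<and> x < fst (s j) \<and> fst (s j) \<le> y \<and> snd (s j) = i}"
    unfolding ranks_of_def
    using sample_rank_le_iff[of _ n s x] sample_rank_le_iff[of _ n s y] by (auto simp: not_le[symmetric])
  then show ?thesis
    by (simp add: card_image inj_on_subset[OF inj_sample_rank] subset_iff)
qed

lemma count_le_mono: "x \<le> y \<Longrightarrow> count_le n s x \<le> count_le n s y"
  unfolding count_le_def by (rule card_mono) auto

text \<open>The ratio is the product over the ranks between the two counts. It is obtained as a
  factor rather than a quotient because \<open>km_cdf n s i y\<close> may vanish: rank 1 contributes
  the factor 0.\<close>

lemma km_cdf_ratio:
  fixes n i :: nat and s :: "nat \<Rightarrow> real \<times> nat"
  assumes "x \<le> y"
  defines "m \<equiv> card {j. j < n \<and> x < fst (s j) \<and> fst (s j) \<le> y \<and> snd (s j) = i}"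
  obtains r where "km_cdf n s i x = r * km_cdf n s i y" "0 \<le> r" "r \<le> 1"
    "real (count_le n s x) / (real (count_le n s x) + real m) \<le> r"
    "r * real (count_le n s y) \<le> real (count_le n s y) - real m"
    "m \<le> count_le n s y - count_le n s x"
proof
  let ?N = "count_le n s"
  let ?S = "ranks_of n s i"
  let ?r = "\<Prod>l\<in>?S \<inter> {?N x<..?N y}. 1 - 1 / real l"
  have "?S \<inter> {?N x<..} = (?S \<inter> {?N x<..?N y}) \<union> (?S \<inter> {?N y<..})"
    using count_le_mono[OF assms(1), of n s] by auto
  then show "km_cdf n s i x = ?r * km_cdf n s i y"
    unfolding km_cdf_def using finite_ranks_of
    by (simp only:) (rule prod.union_disjoint, auto)
  note b = km_ratio_bounds[OF count_le_mono[OF assms(1), of n s], of ?S]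
  show "0 \<le> ?r" "?r \<le> 1"
    "real (count_le n s x) / (real (count_le n s x) + real m) \<le> ?r"
    "?r * real (count_le n s y) \<le> real (count_le n s y) - real m"
    "m \<le> count_le n s y - count_le n s x"
    using b unfolding card_ranks_between[OF assms(1)] m_def by auto
qed

lemma km_cdf_nonneg: "0 \<le> km_cdf n s i x"
  unfolding km_cdf_def by (rule prod_nonneg) (auto simp: field_simps)

lemma km_cdf_mono: "x \<le> y \<Longrightarrow> km_cdf n s i x \<le> km_cdf n s i y"
  by (rule km_cdf_ratio[of x y n s i]) (auto simp: km_cdf_nonneg mult_left_le_one_le)

lemma km_cdf_top:
  assumes "\<And>j. j < n \<Longrightarrow> fst (s j) \<le> x"
  shows "km_cdf n s i x = 1"
proof -
  have "ranks_of n s i \<inter> {count_le n s x<..} = {}"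
    using sample_rank_le_iff[of _ n s x] assms unfolding ranks_of_def by fastforce
  then show ?thesis unfolding km_cdf_def by simp
qed

section \<open>Rounding of the breakpoints\<close>

lemma sample_cell_le: "sample_cell n s j \<le> n"
  unfolding sample_cell_def
  using card_mono[of "{..<n}" "{q. q < n \<and> real q < fst (s j) * real n}"] by auto

text \<open>The cell is the ceiling of n times the bid, so rounding moves a breakpoint to the right
  by at most 1 / n.\<close>

lemma sample_cell_bounds:
  assumes "0 < n" "0 \<le> fst (s j)" "fst (s j) \<le> 1"
  shows "fst (s j) \<le> real (sample_cell n s j) / real n"
    "real (sample_cell n s j) / real n \<le> fst (s j) + 1 / real n"
proof -
  define y where "y = fst (s j) * real n"
  define c where "c = nat \<lceil>y\<rceil>"
  have y: "0 \<le> y" "y \<le> real n" using assms by (auto simp: y_def mult_left_le_one_le)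
  have c: "real c - 1 < y" "y \<le> real c" unfolding c_def using y by linarith+
  \<comment> \<open>Bids are at most 1, so the restriction q < n cuts nothing off.\<close>
  have "{q. q < n \<and> real q < y} = {..<c}"
    using y c by (auto simp: c_def) linarith+
  then have "sample_cell n s j = c" unfolding sample_cell_def y_def by simp
  then show "fst (s j) \<le> real (sample_cell n s j) / real n"
    "real (sample_cell n s j) / real n \<le> fst (s j) + 1 / real n"
    using c assms(1) by (auto simp: y_def field_simps)
qed

text \<open>Moving breakpoints to the right only lowers a step function with nonnegative jumps. In
  the other direction a shift of the argument by 1 / n compensates for it.\<close>

lemma km_est_le_km_cdf:
  assumes "0 < n" "\<And>j. j < n \<Longrightarrow> 0 \<le> fst (s j) \<and> fst (s j) \<le> 1" "0 \<le> x"
  shows "km_est k n s i x \<le> km_cdf n s i x"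
  unfolding km_weight_sum[OF assms(3), symmetric] km_est_def km_fun_def
proof (rule sum_mono)
  fix l
  show "(if (if l < n then real (sample_cell n s l) / real n else 0) \<le> x
      then km_weight n (sample_rank n s) (\<lambda>j. snd (s j)) i l else 0) \<le>
     (if (if l < n then fst (s l) else 0) \<le> x
      then km_weight n (sample_rank n s) (\<lambda>j. snd (s j)) i l else 0)"
    using assms(1,2) sample_cell_bounds(1)[of n s l] km_weight_nonneg[of n s i l] by auto
qed

lemma km_cdf_le_km_est:
  assumes "0 < n" "\<And>j. j < n \<Longrightarrow> 0 \<le> fst (s j) \<and> fst (s j) \<le> 1" "1 / real n \<le> x"
  shows "km_cdf n s i (x - 1 / real n) \<le> km_est k n s i x"
proof -
  have "0 \<le> x - 1 / real n" using assms(3) by simp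
  note km_weight_sum[OF this, where n = n and s = s and i = i, symmetric]
  also have "(\<Sum>l\<le>n. if (if l < n then fst (s l) else 0) \<le> x - 1 / real n
     then km_weight n (sample_rank n s) (\<lambda>j. snd (s j)) i l else 0) \<le> km_est k n s i x"
    unfolding km_est_def km_fun_def
  proof (rule sum_mono)
    fix l
    have "0 \<le> x" using assms(1,3) by (meson divide_nonneg_nonneg of_nat_0_le_iff order_trans zero_le_one)
    then show "(if (if l < n then fst (s l) else 0) \<le> x - 1 / real n
        then km_weight n (sample_rank n s) (\<lambda>j. snd (s j)) i l else 0) \<le>
       (if (if l < n then real (sample_cell n s l) / real n else 0) \<le> x
        then km_weight n (sample_rank n s) (\<lambda>j. snd (s j)) i l else 0)"
      using assms(1,2) sample_cell_bounds(2)[of n s l] km_weight_nonneg[of n s i l] by auto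
  qed
  finally show ?thesis .
qed

text \<open>Evaluation of \<open>km_weight_sum\<close> at a point beyond 0 and all bids. Nothing is
  assumed about the samples, so the estimate is a distribution function for every input and not just
  almost surely.\<close>

lemma km_weight_total: "(\<Sum>l\<le>n. km_weight n (sample_rank n s) (\<lambda>j. snd (s j)) i l) = 1"
proof -
  define x where "x = Max (insert 0 ((\<lambda>j. fst (s j)) ` {..<n}))"
  have x: "0 \<le> x" "\<And>j. j < n \<Longrightarrow> fst (s j) \<le> x"
    unfolding x_def by (auto intro: Max_ge)
  have "(if l < n then fst (s l) else 0) \<le> x" for l
    using x by simp
  then show ?thesis
    using km_weight_sum[OF x(1), where n = n and s = s and i = i] km_cdf_top[of n s x i] x(2)
    by simp
qed

lemma km_est_top: "1 \<le> x \<Longrightarrow> km_est k n s i x = 1"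
proof -
  assume "1 \<le> x"
  then have "(if l < n then real (sample_cell n s l) / real n else 0) \<le> x" for l
    using sample_cell_le[of n s l] by (auto simp: divide_le_eq intro: order_trans[of _ "real n"] mult_le_cancel_right1[THEN iffD2])
  then show ?thesis unfolding km_est_def km_fun_def using km_weight_total by simp
qed

lemma km_est_mono: "x \<le> y \<Longrightarrow> km_est k n s i x \<le> km_est k n s i y"
  unfolding km_est_def km_fun_def
  by (rule sum_mono) (auto simp: km_weight_nonneg)

section \<open>Quantile couplings\<close>

lemma cdf_on_unit_props:
  assumes "cdf_on_unit F"
  shows "mono F" "\<And>x. x < 0 \<Longrightarrow> F x = 0" "\<And>x. 1 \<le> x \<Longrightarrow> F x = 1" "\<And>x. 0 \<le> F x" "\<And>x. F x \<le> 1"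
    "real_distribution (interval_measure F)" "cdf (interval_measure F) = F"
proof -
  obtain M where M: "real_distribution M" "F = cdf M"
    and 0: "\<And>x. x < 0 \<Longrightarrow> F x = 0" and 1: "F 1 = 1"
    using assms unfolding cdf_on_unit_def by auto
  interpret real_distribution M by fact
  show "mono F" unfolding M(2) by (intro monoI cdf_nondecreasing)
  then have mono: "x \<le> y \<Longrightarrow> F x \<le> F y" for x y by (rule monoD)
  show le1: "F x \<le> 1" and "0 \<le> F x" for x unfolding M(2) by (auto simp: cdf_bounded_prob cdf_nonneg)
  show "x < 0 \<Longrightarrow> F x = 0" for x by fact
  show "1 \<le> x \<Longrightarrow> F x = 1" for x using mono[of 1 x] 1 le1[of x] by simp
  have rc: "continuous (at_right a) F" for a unfolding M(2) by (rule cdf_is_right_cont)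
  have bot: "(F \<longlongrightarrow> 0) at_bot" unfolding M(2) by (rule cdf_lim_at_bot)
  have top: "(F \<longlongrightarrow> 1) at_top" unfolding M(2) by (rule cdf_lim_at_top_prob)
  show "real_distribution (interval_measure F)"
    using mono rc bot top by (rule real_distribution_interval_measure)
  show "cdf (interval_measure F) = F"
    using mono rc bot by (rule cdf_interval_measure)
qed

text \<open>Inverse transform sampling: the quantile function pushes the uniform law on (0,1) to the
  law of \<open>F\<close>, and it forms a Galois connection with \<open>F\<close>. The endpoint 0 is
  left out because \<open>{x. 0 \<le> F x}\<close> is the whole line.\<close>

lemma cdf_on_unit_quantile:
  assumes "cdf_on_unit F"
  defines "Q \<equiv> \<lambda>u. Inf {x. u \<le> F x}"
  shows "distr (restrict_space lborel {0<..<1}) borel Q = interval_measure F"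
    "Q \<in> borel_measurable (restrict_space borel {0<..<1})"
    "\<And>u x. u \<in> {0<..<1} \<Longrightarrow> u \<le> F x \<longleftrightarrow> Q u \<le> x"
    "\<And>u. u \<in> {0<..<1} \<Longrightarrow> Q u \<in> {0..1}"
proof -
  note F = cdf_on_unit_props[OF assms(1)]
  interpret cdf_distribution "interval_measure F"
    unfolding cdf_distribution_def by (rule F(6))
  show "distr (restrict_space lborel {0<..<1}) borel Q = interval_measure F"
    using distr_I_eq_M unfolding F(7) Q_def .
  show "Q \<in> borel_measurable (restrict_space borel {0<..<1})"
    using measurable_CI unfolding F(7) Q_def .
  show *: "u \<le> F x \<longleftrightarrow> Q u \<le> x" if "u \<in> {0<..<1}" for u x
    using pseudoinverse[of u x] that unfolding F(7) Q_def by simp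
  show "Q u \<in> {0..1}" if u: "u \<in> {0<..<1}" for u
  proof -
    have "u \<le> F (Q u)" using *[OF u, of "Q u"] by simp
    then have "0 \<le> Q u" using F(2)[of "Q u"] u by (cases "Q u < 0") auto
    moreover have "Q u \<le> 1" using *[OF u, of 1] F(3)[of 1] u by simp
    ultimately show ?thesis by simp
  qed
qed

text \<open>Both quantile functions are driven by the same uniform variable. Since u \<le> F (Q F u)
  \<le> G (Q F u + b), the Galois connection gives Q G u \<le> Q F u + b, and symmetrically; the
  coupled points are never more than b apart.\<close>

lemma wasserstein_le:
  assumes F: "cdf_on_unit F" and G: "cdf_on_unit G"
    and FG: "\<And>x. x \<in> {0..1} \<Longrightarrow> F x \<le> G (x + b)" and GF: "\<And>x. x \<in> {0..1} \<Longrightarrow> G x \<le> F (x + b)"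
  shows "wasserstein (interval_measure F) (interval_measure G) \<le> ennreal b"
proof -
  define Q where "Q F u = Inf {x. u \<le> F x}" for F :: "real \<Rightarrow> real" and u
  note QF = cdf_on_unit_quantile[OF F, folded Q_def]
  note QG = cdf_on_unit_quantile[OF G, folded Q_def]
  let ?U = "restrict_space lborel {0<..<1} :: real measure"
  interpret U: prob_space ?U
    by (auto simp: emeasure_restrict_space space_restrict_space intro!: prob_spaceI)
  have sets_eq: "sets ?U = sets (restrict_space borel {0<..<1})"
    by (rule sets_restrict_space_cong) simp
  have m: "Q F \<in> borel_measurable ?U" "Q G \<in> borel_measurable ?U"
    using QF(2) QG(2) unfolding measurable_cong_sets[OF sets_eq refl] by auto
  then have mp: "(\<lambda>u. (Q F u, Q G u)) \<in> measurable ?U (borel \<Otimes>\<^sub>M borel)"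
    by (rule measurable_Pair)
  define R where "R = distr ?U (borel \<Otimes>\<^sub>M borel) (\<lambda>u. (Q F u, Q G u))"
  have sp: "space ?U = {0<..<1}" by (simp add: space_restrict_space)
  have "coupling (interval_measure F) (interval_measure G) R"
    unfolding coupling_def
  proof (intro conjI)
    show "prob_space R" unfolding R_def using mp by (rule U.prob_space_distr)
    show "sets R = sets (borel \<Otimes>\<^sub>M borel)" by (simp add: R_def)
    show "distr R borel fst = interval_measure F"
      unfolding R_def using mp by (subst distr_distr) (auto simp: comp_def QF(1))
    show "distr R borel snd = interval_measure G"
      unfolding R_def using mp by (subst distr_distr) (auto simp: comp_def QG(1))
    have "{0..1} \<times> {0..1} \<in> sets (borel \<Otimes>\<^sub>M borel :: (real \<times> real) measure)" by simp
    then show "AE z in R. z \<in> {0..1} \<times> {0..1}"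
      unfolding R_def using QF(4) QG(4) sp mp by (subst AE_distr_iff) (auto simp: pred_def)
  qed
  then have "wasserstein (interval_measure F) (interval_measure G) \<le>
      (\<integral>\<^sup>+ z. ennreal \<bar>fst z - snd z\<bar> \<partial>R)"
    unfolding wasserstein_def by (intro INF_lower) simp
  also have "\<dots> = (\<integral>\<^sup>+ u. ennreal \<bar>Q F u - Q G u\<bar> \<partial>?U)"
    unfolding R_def using mp by (subst nn_integral_distr) auto
  also have "\<dots> \<le> (\<integral>\<^sup>+ u. ennreal b \<partial>?U)"
  proof (rule nn_integral_mono)
    fix u assume "u \<in> space ?U"
    then have u: "u \<in> {0<..<1}" using sp by simp
    have "u \<le> G (Q F u + b)"
      using QF(3)[OF u, of "Q F u"] FG[OF QF(4)[OF u]] by simp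
    then have "Q G u \<le> Q F u + b" using QG(3)[OF u] by simp
    moreover have "u \<le> F (Q G u + b)"
      using QG(3)[OF u, of "Q G u"] GF[OF QG(4)[OF u]] by simp
    then have "Q F u \<le> Q G u + b" using QF(3)[OF u] by simp
    ultimately show "ennreal \<bar>Q F u - Q G u\<bar> \<le> ennreal b"
      by (intro ennreal_leI) linarith
  qed
  also have "\<dots> = ennreal b" using U.emeasure_space_1 by simp
  finally show ?thesis .
qed

lemma cdf_on_unit_sum:
  assumes fin: "finite L" and w: "\<And>l. l \<in> L \<Longrightarrow> 0 \<le> w l" "sum w L = 1"
    and b: "\<And>l. l \<in> L \<Longrightarrow> b l \<in> {0..1}"
  shows "cdf_on_unit (\<lambda>x. \<Sum>l\<in>L. if b l \<le> x then w l else 0)" (is "cdf_on_unit ?F")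
proof -
  have 0: "?F x = 0" if "x < 0" for x
    using that b by (intro sum.neutral) force
  have 1: "?F x = 1" if "1 \<le> x" for x
    unfolding w(2)[symmetric] using that b by (intro sum.cong) force+
  have mono: "?F x \<le> ?F y" if "x \<le> y" for x y
    using that w(1) by (intro sum_mono) auto
  have rc: "continuous (at_right a) ?F" for a
  proof (intro continuous_sum)
    fix l
    have "eventually (\<lambda>x. (if b l \<le> x then w l else 0) = (if b l \<le> a then w l else 0)) (at_right a)"
    proof (cases "b l \<le> a")
      case True
      then show ?thesis by (auto simp: eventually_at_right_field intro!: exI[of _ "a + 1"])
    next
      case False
      then show ?thesis by (auto simp: eventually_at_right_field intro!: exI[of _ "b l"])
    qed
    then show "continuous (at_right a) (\<lambda>x. if b l \<le> x then w l else 0)"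
      unfolding continuous_within by (rule tendsto_eventually)
  qed
  have bot: "(?F \<longlongrightarrow> 0) at_bot"
    by (rule tendsto_eventually) (use 0 in \<open>auto simp: eventually_at_bot_dense\<close>)
  have top: "(?F \<longlongrightarrow> 1) at_top"
    by (rule tendsto_eventually) (use 1 in \<open>auto simp: eventually_at_top_linorder\<close>)
  have "real_distribution (interval_measure ?F)"
    by (rule real_distribution_interval_measure[OF mono rc bot top])
  moreover have "cdf (interval_measure ?F) = ?F"
    by (rule cdf_interval_measure[OF mono rc bot])
  ultimately have "\<exists>M. real_distribution M \<and> ?F = cdf M"
    by (intro exI[of _ "interval_measure ?F"] conjI) (simp_all only:)
  moreover have "\<forall>x<0. ?F x = 0" using 0 by blast
  moreover have "?F 1 = 1" using 1[of 1] by blast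
  ultimately show ?thesis
    unfolding cdf_on_unit_def by (intro conjI)
qed

lemma cdf_on_unit_km_est: "cdf_on_unit (km_est k n s i)"
proof -
  have "cdf_on_unit (\<lambda>x. \<Sum>l\<le>n. if (if l < n then real (sample_cell n s l) / real n else 0) \<le> x
     then km_weight n (sample_rank n s) (\<lambda>j. snd (s j)) i l else 0)"
    using sample_cell_le[of n s]
    by (intro cdf_on_unit_sum) (auto simp: km_weight_nonneg km_weight_total divide_le_eq)
  then show ?thesis unfolding km_est_def km_fun_def .
qed

section \<open>The law of the auction data\<close>

lemma measurable_auction_outcome:
  assumes "0 < k" "\<And>i. i \<in> {1..k} \<Longrightarrow> sets (M i) = sets borel"
  shows "auction_outcome k \<in> measurable (PiM {1..k} M) (borel \<Otimes>\<^sub>M count_space UNIV)"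
proof -
  have sets_eq: "sets (PiM {1..k} M) = sets (PiM {1..k} (\<lambda>_. borel :: real measure))"
    by (rule sets_PiM_cong) (use assms in auto)
  have max [measurable]: "(\<lambda>x. Max (x ` {1..k})) \<in> borel_measurable (PiM {1..k} (\<lambda>_. borel :: real measure))"
    using assms(1) by (intro borel_measurable_Max) auto
  have "auction_outcome k \<in> measurable (PiM {1..k} (\<lambda>_. borel)) (borel \<Otimes>\<^sub>M count_space UNIV)"
    unfolding auction_outcome_def
  proof (intro measurable_Pair measurable_Least)
    fix i
    show "(\<lambda>x. i \<in> {1..k} \<and> x i = Max (x ` {1..k})) \<in>
        measurable (PiM {1..k} (\<lambda>_. borel :: real measure)) (count_space UNIV)"
    proof (rule pred_intros_conj1')
      assume "i \<in> {1..k}"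
      then have comp: "(\<lambda>x. x i) \<in> borel_measurable (PiM {1..k} (\<lambda>_. borel :: real measure))"
        by (rule measurable_component_singleton)
      show "Measurable.pred (PiM {1..k} (\<lambda>_. borel :: real measure)) (\<lambda>x. x i = Max (x ` {1..k}))"
        unfolding pred_def by (rule borel_measurable_eq[OF comp max])
    qed
  qed (rule max)
  then show ?thesis unfolding measurable_cong_sets[OF sets_eq refl] .
qed

lemma measure_PiM_interval_measure:
  fixes k :: nat
  assumes F: "\<And>i. i \<in> {1..k} \<Longrightarrow> cdf_on_unit (F i)" and k: "0 < k"
    and A: "\<And>i. i \<in> {1..k} \<Longrightarrow> A i \<in> sets borel"
  shows "measure (\<Pi>\<^sub>M i\<in>{1..k}. interval_measure (F i)) (\<Pi>\<^sub>E i\<in>{1..k}. A i) =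
    (\<Prod>i\<in>{1..k}. measure (interval_measure (F i)) (A i))"
proof -
  \<comment> \<open>The product locale asks for a probability space at every index;
    \<open>F 1\<close> fills the indices outside the range.\<close>
  define M where "M i = interval_measure (if i \<in> {1..k} then F i else F 1)" for i :: nat
  have "prob_space (M i)" for i
    unfolding M_def
    using cdf_on_unit_props(6)[OF F, of "if i \<in> {1..k} then i else 1"] k
    by (auto simp: real_distribution_def)
  then interpret finite_product_prob_space M "{1..k}"
    by (intro finite_product_prob_space.intro product_prob_space.intro product_prob_space_axioms.intro
      finite_product_sigma_finite.intro finite_product_sigma_finite_axioms.intro
      product_sigma_finite.intro prob_space_imp_sigma_finite finite_atLeastAtMost) auto
  have "(\<Pi>\<^sub>M i\<in>{1..k}. interval_measure (F i)) = PiM {1..k} M"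
    by (rule PiM_cong) (auto simp: M_def)
  moreover have "prob (\<Pi>\<^sub>E i\<in>{1..k}. A i) = (\<Prod>i\<in>{1..k}. measure (M i) (A i))"
    by (rule prob_times) (use A in \<open>auto simp: M_def\<close>)
  moreover have "(\<Prod>i\<in>{1..k}. measure (M i) (A i)) =
      (\<Prod>i\<in>{1..k}. measure (interval_measure (F i)) (A i))"
    by (rule prod.cong) (auto simp: M_def)
  ultimately show ?thesis by (simp only:)
qed

lemma prob_space_first_price_auction:
  assumes F: "\<And>i. i \<in> {1..k} \<Longrightarrow> cdf_on_unit (F i)" and k: "0 < k"
  shows "prob_space (first_price_auction k F)"
    "sets (first_price_auction k F) = sets (borel \<Otimes>\<^sub>M count_space UNIV)"
proof -
  have "prob_space (\<Pi>\<^sub>M i\<in>{1..k}. interval_measure (F i))"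
    by (rule prob_space_PiM) (use cdf_on_unit_props(6)[OF F] in \<open>auto simp: real_distribution_def\<close>)
  then show "prob_space (first_price_auction k F)"
    unfolding first_price_auction_def
    by (rule prob_space.prob_space_distr) (rule measurable_auction_outcome, use k in auto)
  show "sets (first_price_auction k F) = sets (borel \<Otimes>\<^sub>M count_space UNIV)"
    by (simp add: first_price_auction_def)
qed

lemma measure_first_price_auction:
  assumes k: "0 < k" and A: "A \<in> sets (borel \<Otimes>\<^sub>M count_space UNIV)"
  shows "measure (first_price_auction k F) A =
    measure (\<Pi>\<^sub>M i\<in>{1..k}. interval_measure (F i))
      {x \<in> space (\<Pi>\<^sub>M i\<in>{1..k}. interval_measure (F i)). auction_outcome k x \<in> A}"
  unfolding first_price_auction_def
  by (subst measure_distr[OF measurable_auction_outcome]) (use k A in \<open>auto intro!: arg_cong2[where f = measure]\<close>)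

lemma auction_outcome_fst_le:
  "0 < k \<Longrightarrow> fst (auction_outcome k x) \<le> y \<longleftrightarrow> (\<forall>i\<in>{1..k}. x i \<le> y)"
  unfolding auction_outcome_def by (auto simp: Max_le_iff)

lemma auction_outcome_snd:
  assumes "0 < k"
  shows "snd (auction_outcome k x) \<in> {1..k}"
    "x (snd (auction_outcome k x)) = fst (auction_outcome k x)"
proof -
  have "Max (x ` {1..k}) \<in> x ` {1..k}" using assms by (intro Max_in) auto
  then obtain i where "i \<in> {1..k} \<and> x i = Max (x ` {1..k})" by auto
  from LeastI[of "\<lambda>i. i \<in> {1..k} \<and> x i = Max (x ` {1..k})", OF this]
  show "snd (auction_outcome k x) \<in> {1..k}"
    "x (snd (auction_outcome k x)) = fst (auction_outcome k x)"
    unfolding auction_outcome_def by auto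
qed

lemma measure_interval_measure_unit:
  assumes "cdf_on_unit F"
  shows "measure (interval_measure F) {..x} = F x"
    "x \<le> y \<Longrightarrow> measure (interval_measure F) {x<..y} = F y - F x"
proof -
  note F = cdf_on_unit_props[OF assms]
  interpret real_distribution "interval_measure F" by (rule F(6))
  show "measure (interval_measure F) {..x} = F x"
    using F(7) unfolding cdf_def by (rule fun_cong)
  show "measure (interval_measure F) {x<..y} = F y - F x" if "x \<le> y"
    using cdf_diff_eq[of x y] F(7) that by (cases "x = y") auto
qed

lemma sets_auction_le:
  "{z. fst z \<le> (x :: real)} \<in> sets (borel \<Otimes>\<^sub>M count_space (UNIV :: nat set))"
proof -
  have "{z \<in> space (borel \<Otimes>\<^sub>M count_space (UNIV :: nat set)). fst z \<le> (x :: real)} \<in>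
      sets (borel \<Otimes>\<^sub>M count_space UNIV)"
    by measurable
  then show ?thesis by (simp add: space_pair_measure)
qed

lemma sets_auction_win:
  "{z. x < fst z \<and> fst z \<le> (y :: real) \<and> snd z = i} \<in> sets (borel \<Otimes>\<^sub>M count_space (UNIV :: nat set))"
proof -
  have "{z \<in> space (borel \<Otimes>\<^sub>M count_space (UNIV :: nat set)). x < fst z \<and> fst z \<le> y \<and> snd z = i} \<in>
      sets (borel \<Otimes>\<^sub>M count_space UNIV)"
    by measurable
  then show ?thesis by (simp add: space_pair_measure)
qed

lemma first_price_auction_max:
  assumes F: "\<And>i. i \<in> {1..k} \<Longrightarrow> cdf_on_unit (F i)" and k: "0 < k"
  shows "measure (first_price_auction k F) {z. fst z \<le> x} = (\<Prod>i\<in>{1..k}. F i x)"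
proof -
  let ?P = "\<Pi>\<^sub>M i\<in>{1..k}. interval_measure (F i)"
  have "measure (first_price_auction k F) {z. fst z \<le> x} =
      measure ?P {y \<in> space ?P. auction_outcome k y \<in> {z. fst z \<le> x}}"
    using k sets_auction_le by (rule measure_first_price_auction)
  also have "{y \<in> space ?P. auction_outcome k y \<in> {z. fst z \<le> x}} = (\<Pi>\<^sub>E i\<in>{1..k}. {..x})"
    using k by (auto simp: auction_outcome_fst_le space_PiM PiE_iff extensional_def)
  also have "measure ?P \<dots> = (\<Prod>i\<in>{1..k}. F i x)"
    using F k by (subst measure_PiM_interval_measure) (auto simp: measure_interval_measure_unit)
  finally show ?thesis .
qed

text \<open>The event lies between two boxes, so no integral over the bid of \<open>i\<close> is
  computed. If the bid of \<open>i\<close> is in (x,y] and the others are at most x, then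
  \<open>i\<close> is the strict maximum; if \<open>i\<close> wins with a bid in (x,y], the others
  are at most y.\<close>

lemma first_price_auction_win:
  assumes F: "\<And>i. i \<in> {1..k} \<Longrightarrow> cdf_on_unit (F i)" and i: "i \<in> {1..k}" and "x \<le> y"
  defines "d \<equiv> measure (first_price_auction k F) {z. x < fst z \<and> fst z \<le> y \<and> snd z = i}"
  shows "(F i y - F i x) * (\<Prod>j\<in>{1..k}-{i}. F j x) \<le> d"
    "d \<le> (F i y - F i x) * (\<Prod>j\<in>{1..k}-{i}. F j y)"
proof -
  let ?P = "\<Pi>\<^sub>M i\<in>{1..k}. interval_measure (F i)"
  have k: "0 < k" using i by auto
  interpret P: prob_space ?P
    by (rule prob_space_PiM) (use cdf_on_unit_props(6)[OF F] in \<open>auto simp: real_distribution_def\<close>)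
  let ?B = "\<lambda>z. \<Pi>\<^sub>E j\<in>{1..k}. if j = i then {x<..y} else {..z :: real}"
  let ?E = "{w \<in> space ?P. auction_outcome k w \<in> {z. x < fst z \<and> fst z \<le> y \<and> snd z = i}}"
  have d: "d = measure ?P ?E"
    unfolding d_def using k sets_auction_win by (rule measure_first_price_auction)
  have EP: "?E \<in> sets ?P"
    using measurable_sets[OF measurable_auction_outcome[OF k] sets_auction_win, of "\<lambda>i. interval_measure (F i)"]
    by (simp add: vimage_def Int_def conj_commute)
  have B: "?B z \<in> sets ?P" for z
    by (rule sets_PiM_I_finite) auto
  have mB: "measure ?P (?B z) = (F i y - F i x) * (\<Prod>j\<in>{1..k}-{i}. F j z)" for z
  proof -
    have "measure ?P (?B z) =
        (\<Prod>j\<in>{1..k}. measure (interval_measure (F j)) (if j = i then {x<..y} else {..z}))"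
      using F k by (rule measure_PiM_interval_measure) auto
    also have "\<dots> = (F i y - F i x) * (\<Prod>j\<in>{1..k}-{i}. F j z)"
      using F i \<open>x \<le> y\<close> by (subst prod.remove[OF _ i]) (auto simp: measure_interval_measure_unit intro!: prod.cong)
    finally show ?thesis .
  qed
  have "?B x \<subseteq> ?E"
  proof
    fix w assume w: "w \<in> ?B x"
    have wi: "x < w i" "w i \<le> y" and wj: "\<And>j. j \<in> {1..k} \<Longrightarrow> j \<noteq> i \<Longrightarrow> w j \<le> x"
      using w i by (auto simp: PiE_iff split: if_splits)
    let ?o = "auction_outcome k w"
    have "fst ?o \<le> w i" unfolding auction_outcome_fst_le[OF k] using wi wj by force
    moreover have "w i \<le> fst ?o" using auction_outcome_fst_le[OF k, of w "fst ?o"] i by auto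
    moreover have "snd ?o = i"
      using auction_outcome_snd[OF k, of w] wj[of "snd ?o"] wi calculation by force
    moreover have "w \<in> space ?P" using w by (auto simp: space_PiM PiE_iff)
    ultimately show "w \<in> ?E" using wi by auto
  qed
  then have "measure ?P (?B x) \<le> d" unfolding d using EP by (rule P.finite_measure_mono)
  then show "(F i y - F i x) * (\<Prod>j\<in>{1..k}-{i}. F j x) \<le> d" unfolding mB .
  have "?E \<subseteq> ?B y"
  proof
    fix w assume w: "w \<in> ?E"
    then have "\<forall>j\<in>{1..k}. w j \<le> y" using auction_outcome_fst_le[OF k] by auto
    moreover have "x < w i" using w auction_outcome_snd(2)[OF k, of w] by auto
    ultimately show "w \<in> ?B y" using w by (auto simp: space_PiM PiE_iff)
  qed
  then have "d \<le> measure ?P (?B y)" unfolding d using B by (rule P.finite_measure_mono)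
  then show "d \<le> (F i y - F i x) * (\<Prod>j\<in>{1..k}-{i}. F j y)" unfolding mB .
qed

text \<open>The bounds have the same form as those for the estimator in \<open>km_cdf_ratio\<close>.\<close>

lemma first_price_auction_ratio:
  assumes F: "\<And>i. i \<in> {1..k} \<Longrightarrow> cdf_on_unit (F i)" and i: "i \<in> {1..k}" and xy: "x \<le> y"
    and pos: "\<And>j. j \<in> {1..k} \<Longrightarrow> 0 < F j x"
  defines "d \<equiv> measure (first_price_auction k F) {z. x < fst z \<and> fst z \<le> y \<and> snd z = i}"
    and "H \<equiv> \<lambda>x. \<Prod>j\<in>{1..k}. F j x"
  obtains r where "F i x = r * F i y" "0 \<le> r" "r \<le> 1" "H x / (H x + d) \<le> r" "r * H y \<le> H y - d"
    "0 \<le> d" "d \<le> H y - H x" "H x / H y \<le> r"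
proof (rule that[of "F i x / F i y"])
  \<comment> \<open>The distribution function of the highest competing bid; \<open>H\<close> is its
    product with \<open>F i\<close>.\<close>
  let ?G = "\<lambda>x. \<Prod>j\<in>{1..k}-{i}. F j x"
  have mono: "F j x \<le> F j y" if "j \<in> {1..k}" for j
    using cdf_on_unit_props(1)[OF F[OF that]] xy by (rule monoD)
  have H: "H z = F i z * ?G z" for z
    unfolding H_def using i by (simp add: prod.remove)
  have "0 < ?G x" by (rule prod_pos) (use pos in auto)
  moreover have "?G x \<le> ?G y"
    by (rule prod_mono) (use pos mono in \<open>auto intro: less_imp_le\<close>)
  ultimately have G: "0 < ?G x" "?G x \<le> ?G y" by auto
  have u: "0 < F i x" "F i x \<le> F i y" using pos[OF i] mono[OF i] by auto
  have d: "(F i y - F i x) * ?G x \<le> d" "d \<le> (F i y - F i x) * ?G y"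
    unfolding d_def using first_price_auction_win[OF F i xy] by auto
  have Hpos: "0 < H x" "0 < H y" unfolding H using u G by auto
  show "0 \<le> d" unfolding d_def by simp
  show "F i x = F i x / F i y * F i y" "0 \<le> F i x / F i y" "F i x / F i y \<le> 1"
    using u by auto
  have "H x * F i y \<le> F i x * (H x + d)"
    using mult_left_mono[OF d(1), of "F i x"] u unfolding H by (simp add: algebra_simps)
  then show "H x / (H x + d) \<le> F i x / F i y"
    using Hpos u \<open>0 \<le> d\<close> by (simp add: field_simps)
  have "F i x * H y \<le> (H y - d) * F i y"
    using mult_right_mono[OF d(2), of "F i y"] u unfolding H by (simp add: algebra_simps)
  then show "F i x / F i y * H y \<le> H y - d"
    using u by (simp add: field_simps)
  have "F i x * ?G x \<le> F i x * ?G y" using u G by (intro mult_left_mono) auto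
  then show "d \<le> H y - H x" using d(2) unfolding H by (simp add: algebra_simps)
  show "H x / H y \<le> F i x / F i y"
    unfolding H using u G by (simp add: field_simps)
qed

section \<open>Concentration and measurability\<close>

lemma sample_count_concentration:
  fixes M :: "'a measure"
  assumes M: "prob_space M" and A: "A \<in> sets M" and n: "0 < n" and t: "0 \<le> t"
  shows "measure (\<Pi>\<^sub>M j\<in>{..<n}. M) {s \<in> space (\<Pi>\<^sub>M j\<in>{..<n}. M).
      t \<le> \<bar>real (card {j. j < n \<and> s j \<in> A}) / real n - measure M A\<bar>} \<le> 2 * exp (- 2 * real n * t\<^sup>2)"
proof -
  let ?P = "\<Pi>\<^sub>M j\<in>{..<n}. M"
  interpret M: prob_space M by fact
  interpret P: prob_space ?P by (rule prob_space_PiM) (rule M)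
  let ?X = "\<lambda>j s. indicator A (s j) :: real"
  have m: "?X j \<in> borel_measurable ?P" if "j \<in> {..<n}" for j
    by (rule measurable_compose[OF measurable_component_singleton[OF that]]) (use A in simp)
  have dX: "distr ?P borel (?X j) = distr M borel (indicator A)" if "j \<in> {..<n}" for j
  proof -
    have "distr ?P borel (?X j) = distr (distr ?P M (\<lambda>s. s j)) borel (indicator A)"
      using that A by (subst distr_distr) (auto simp: comp_def intro!: measurable_component_singleton)
    also have "distr ?P M (\<lambda>s. s j) = M"
      using that M by (intro distr_PiM_component) auto
    finally show ?thesis .
  qed
  have "P.indep_vars (\<lambda>_. M) (\<lambda>j s. s j) {..<n}"
  proof (rule iffD2[OF P.indep_vars_iff_distr_eq_PiM'])
    show "{..<n} \<noteq> {}" using n by auto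
    show "\<And>j. j \<in> {..<n} \<Longrightarrow> P.random_variable M (\<lambda>s. s j)" by (rule measurable_component_singleton)
    \<comment> \<open>On the product space the joint map of the coordinates is the identity, so its
      law is the product of the marginals.\<close>
    have "distr ?P ?P (\<lambda>s. \<lambda>j\<in>{..<n}. s j) = distr ?P ?P (\<lambda>s. s)"
      by (rule distr_cong) (auto simp: space_PiM)
    moreover have "(\<Pi>\<^sub>M j\<in>{..<n}. distr ?P M (\<lambda>s. s j)) = ?P"
      by (rule PiM_cong) (auto intro!: distr_PiM_component M)
    ultimately show "distr ?P ?P (\<lambda>s. \<lambda>j\<in>{..<n}. s j) = (\<Pi>\<^sub>M j\<in>{..<n}. distr ?P M (\<lambda>s. s j))"
      by (simp add: distr_id)
  qed
  then have indep: "P.indep_vars (\<lambda>_. borel) ?X {..<n}"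
    using A by (intro P.indep_vars_compose2[where Y = "\<lambda>_. indicator A"]) auto
  interpret H: Hoeffding_ineq_iid ?P "{..<n}" ?X "?X 0" 0 1 "P.expectation (?X 0)"
  proof unfold_locales
    show "AE s in ?P. ?X 0 s \<in> {0..1}" by (auto simp: indicator_def)
    show "P.indep_vars (\<lambda>_. borel) ?X {..<n}" by fact
    show "?X 0 \<in> borel_measurable ?P" using n by (intro m) auto
    show "distr ?P borel (?X j) = distr ?P borel (?X 0)" if "j \<in> {..<n}" for j
      using dX[OF that] dX[of 0] n by simp
  qed simp_all
  have "P.expectation (?X 0) = integral\<^sup>L (distr ?P borel (?X 0)) (\<lambda>x. x)"
    using n m by (intro integral_distr[symmetric]) auto
  also have "\<dots> = integral\<^sup>L (distr M borel (indicator A)) (\<lambda>x. x)"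
    using dX[of 0] n by simp
  also have "\<dots> = measure M A"
    using A by (subst integral_distr) auto
  finally have E: "P.expectation (?X 0) = measure M A" .
  have "(\<Sum>j\<in>{..<n}. ?X j s) = real (card {j. j < n \<and> s j \<in> A})" for s
  proof -
    have "(\<Sum>j\<in>{..<n}. ?X j s) = real (card {j\<in>{..<n}. s j \<in> A})"
      by (simp add: indicator_def sum.If_cases Int_def)
    then show ?thesis by simp
  qed
  moreover have ne: "{..<n} \<noteq> {}" using n by auto
  ultimately show ?thesis
    using H.Hoeffding_ineq_abs_ge'[OF t zero_less_one ne] unfolding E by simp
qed

section \<open>Measurability of the estimate\<close>

lemma sets_sample_count:
  fixes M :: "'a measure" and n :: nat
  assumes E: "E \<in> sets M"
  shows "{s \<in> space (\<Pi>\<^sub>M j\<in>{..<n}. M). Q (card {j. j < n \<and> s j \<in> E})} \<in> sets (\<Pi>\<^sub>M j\<in>{..<n}. M)"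
proof -
  let ?P = "\<Pi>\<^sub>M j\<in>{..<n}. M"
  have "(\<lambda>s. card {j. j < n \<and> s j \<in> E}) \<in> measurable ?P (count_space UNIV)"
  proof (rule measurable_card)
    fix j :: nat
    have "Measurable.pred ?P (\<lambda>s. j < n \<and> s j \<in> E)"
    proof (rule pred_intros_conj1')
      assume "j < n"
      then have "(\<lambda>s. s j) \<in> measurable ?P M" by (intro measurable_component_singleton) simp
      then show "Measurable.pred ?P (\<lambda>s. s j \<in> E)" using E by (rule pred_sets2[rotated])
    qed
    then show "{s \<in> space ?P. j \<in> {j. j < n \<and> s j \<in> E}} \<in> sets ?P"
      unfolding pred_def mem_Collect_eq .
  qed
  then have "(\<lambda>s. Q (card {j. j < n \<and> s j \<in> E})) \<in> measurable ?P (count_space UNIV)"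
    by (rule measurable_compose) simp
  then show ?thesis unfolding pred_def .
qed

text \<open>The values of \<open>f\<close> split the space into countably many measurable pieces on
  which only \<open>g\<close> varies, so \<open>h\<close> may be arbitrary.\<close>

lemma measurable_count_space_map2:
  fixes f :: "'a \<Rightarrow> 'b :: countable" and g :: "'a \<Rightarrow> 'c :: countable"
  assumes f: "f \<in> measurable M (count_space UNIV)" and g: "g \<in> measurable M (count_space UNIV)"
  shows "(\<lambda>x. h (f x) (g x)) \<in> measurable M (count_space UNIV)"
proof (rule measurable_compose_countable[OF _ f, of "\<lambda>a x. h a (g x)"])
  show "(\<lambda>x. h a (g x)) \<in> measurable M (count_space UNIV)" for a
    by (rule measurable_compose[OF g]) simp
qed

lemma measurable_count_space_list:
  fixes f :: "'i \<Rightarrow> 'a \<Rightarrow> 'b :: countable"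
  assumes "\<And>j. j \<in> set xs \<Longrightarrow> f j \<in> measurable M (count_space UNIV)"
  shows "(\<lambda>x. map (\<lambda>j. f j x) xs) \<in> measurable M (count_space UNIV)"
  using assms by (induction xs) (auto intro: measurable_count_space_map2)

lemma km_fun_cong:
  assumes "\<And>j. j < n \<Longrightarrow> R j = R' j" "\<And>j. j < n \<Longrightarrow> c j = c' j" "\<And>j. j < n \<Longrightarrow> Z j = Z' j"
  shows "km_fun n R c Z i = km_fun n R' c' Z' i"
proof
  fix x
  have "rank_prod n R Z i r = rank_prod n R' Z' i r" for r
    unfolding rank_prod_def using assms by (intro prod.cong) auto
  then have "km_weight n R Z i l = km_weight n R' Z' i l" for l
    unfolding km_weight_def using assms by auto
  then show "km_fun n R c Z i x = km_fun n R' c' Z' i x"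
    unfolding km_fun_def using assms(2) by (intro sum.cong) auto
qed

text \<open>The estimate takes only countably many values, since it depends on the samples only through
  their ranks, rounded bids and winners; so \<open>Q\<close> can be arbitrary.\<close>

lemma sets_km_est:
  assumes M: "sets M = sets (borel \<Otimes>\<^sub>M count_space UNIV)"
  shows "{s \<in> space (\<Pi>\<^sub>M j\<in>{..<n}. M). Q (km_est k n s i)} \<in> sets (\<Pi>\<^sub>M j\<in>{..<n}. M)"
proof -
  let ?P = "\<Pi>\<^sub>M j\<in>{..<n}. M"
  have comp: "(\<lambda>s. s j) \<in> measurable ?P (borel \<Otimes>\<^sub>M count_space UNIV)" if "j < n" for j
    using measurable_component_singleton[of j "{..<n}" "\<lambda>_. M"] that
    by (simp add: measurable_cong_sets[OF refl M])
  have Y: "(\<lambda>s. fst (s j)) \<in> borel_measurable ?P" if "j < n" for j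
    by (rule measurable_compose[OF comp[OF that]]) simp
  have Z: "(\<lambda>s. snd (s j)) \<in> measurable ?P (count_space UNIV)" if "j < n" for j
    by (rule measurable_compose[OF comp[OF that]]) simp
  have less: "Measurable.pred ?P (\<lambda>s. fst (s l) < fst (s j))" if "l < n" "j < n" for l j
    unfolding pred_def by (rule borel_measurable_less[OF Y[OF that(1)] Y[OF that(2)]])
  have R: "(\<lambda>s. sample_rank n s j) \<in> measurable ?P (count_space UNIV)" if "j < n" for j
    unfolding sample_rank_def
  proof (rule measurable_card)
    fix l
    have "Measurable.pred ?P (\<lambda>s. l < n \<and> precedes s l j)"
      unfolding precedes_def
      by (intro pred_intros_conj1' pred_intros_logic less that) auto
    then show "{s \<in> space ?P. l \<in> {l. l < n \<and> precedes s l j}} \<in> sets ?P"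
      unfolding pred_def mem_Collect_eq .
  qed
  have C: "(\<lambda>s. sample_cell n s j) \<in> measurable ?P (count_space UNIV)" if "j < n" for j
    unfolding sample_cell_def
  proof (rule measurable_card)
    fix q
    have [measurable]: "(\<lambda>s. fst (s j)) \<in> borel_measurable ?P" by (rule Y[OF that])
    have "Measurable.pred ?P (\<lambda>s. q < n \<and> real q < fst (s j) * real n)" by measurable
    then show "{s \<in> space ?P. q \<in> {q. q < n \<and> real q < fst (s j) * real n}} \<in> sets ?P"
      unfolding pred_def mem_Collect_eq .
  qed
  \<comment> \<open>The discrete data are packed into a list because lists of triples of naturals
    form a countable type, unlike functions on the naturals.\<close>
  define T where "T s = map (\<lambda>j. (sample_rank n s j, sample_cell n s j, snd (s j))) [0..<n]"
    for s :: "nat \<Rightarrow> real \<times> nat"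
  define est where "est T = km_fun n (\<lambda>j. fst (T ! j)) (\<lambda>j. fst (snd (T ! j))) (\<lambda>j. snd (snd (T ! j))) i"
    for T :: "(nat \<times> nat \<times> nat) list"
  have "(\<lambda>s. (sample_rank n s j, sample_cell n s j, snd (s j))) \<in> measurable ?P (count_space UNIV)"
    if "j < n" for j
    using measurable_count_space_map2[OF R[OF that]
        measurable_count_space_map2[OF C[OF that] Z[OF that], of Pair], of Pair] .
  then have T: "T \<in> measurable ?P (count_space UNIV)"
    unfolding T_def by (intro measurable_count_space_list) simp
  have "(\<lambda>s. Q (est (T s))) \<in> measurable ?P (count_space UNIV)"
    by (rule measurable_compose[OF T]) simp
  moreover have "km_est k n s i = est (T s)" for s
    unfolding km_est_def est_def by (rule km_fun_cong) (auto simp: T_def)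
  ultimately show ?thesis unfolding pred_def by (simp only:)
qed

section \<open>From frequencies to the estimator\<close>

text \<open>The condition a \<le> b bounds the numerator by a multiple of b, which cancels and
  leaves \<open>e\<close> as the only denominator.\<close>

lemma abs_quotient_diff_le:
  fixes a b c e :: real
  assumes "0 \<le> a" "a \<le> b" "0 < b" "0 < e" "\<bar>a - c\<bar> \<le> s" "\<bar>b - e\<bar> \<le> t"
  shows "\<bar>a / b - c / e\<bar> \<le> (s + t) / e"
proof -
  have "a / b - c / e = (a * (e - b) + b * (a - c)) / (b * e)"
    using assms by (simp add: field_simps)
  also have "\<bar>\<dots>\<bar> \<le> (b * t + b * s) / (b * e)"
    unfolding abs_divide
  proof (rule frac_le)
    have "\<bar>a * (e - b)\<bar> \<le> b * t" unfolding abs_mult using assms by (intro mult_mono) auto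
    moreover have "\<bar>b * (a - c)\<bar> \<le> b * s" unfolding abs_mult using assms by (intro mult_mono) auto
    ultimately show "\<bar>a * (e - b) + b * (a - c)\<bar> \<le> b * t + b * s" by linarith
    show "0 \<le> b * t + b * s" using assms by (intro add_nonneg_nonneg mult_nonneg_nonneg) auto
  qed (use assms in auto)
  also have "\<dots> = (s + t) / e" using assms by (simp add: field_simps)
  finally show ?thesis .
qed

text \<open>The true ratio lies between 1 - d / (H' + d) and 1 - d / H, the empirical one between
  the same expressions in g, G' and G. The result is the width of the first interval plus the
  distance of corresponding endpoints.\<close>

lemma ratio_close:
  fixes H H' d \<eta> t h r G G' g q :: real
  assumes h: "0 < h" "h \<le> H'" and \<eta>: "0 \<le> \<eta>" "\<eta> \<le> 1 / 2" "(1 - \<eta>) * H \<le> H'"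
    and d: "0 \<le> d" "d \<le> H - H'" and g: "0 \<le> g" "g \<le> G - G'"
    and t: "0 \<le> t" "t \<le> h / 2" "\<bar>G - H\<bar> \<le> t" "\<bar>G' - H'\<bar> \<le> t" "\<bar>g - d\<bar> \<le> t"
    and r: "H' / (H' + d) \<le> r" "r * H \<le> H - d" and q: "G' / (G' + g) \<le> q" "q * G \<le> G - g"
  shows "\<bar>q - r\<bar> \<le> 2 * \<eta>\<^sup>2 + 6 * t / h"
proof -
  have H: "0 < H'" "H' \<le> H" "0 < H" using h d by auto
  have G: "h / 2 \<le> G'" "G' \<le> G" "0 < G'" "0 < G" using h t g by (auto simp: abs_le_iff)
  \<comment> \<open>Both d and H - H' - d are at most \<eta> * H, so the gap is quadratic in \<eta>;
    the 2 comes from H' + d \<ge> H / 2.\<close>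
  have gap: "d / (H' + d) - d / H \<le> 2 * \<eta>\<^sup>2"
  proof -
    have dH: "d \<le> \<eta> * H" using d \<eta> by (simp add: algebra_simps)
    have "H / 2 \<le> (1 - \<eta>) * H" using \<eta> H by simp
    then have "H / 2 \<le> H'" using \<eta> by linarith
    then have half: "H / 2 \<le> H' + d" using d by linarith
    have "d / (H' + d) - d / H = d * (H - H' - d) / ((H' + d) * H)"
      using H d by (simp add: field_simps)
    also have "\<dots> \<le> (\<eta> * H) * (\<eta> * H) / (H / 2 * H)"
    proof (rule frac_le)
      show "d * (H - H' - d) \<le> \<eta> * H * (\<eta> * H)"
        using d dH \<eta> H by (intro mult_mono) (auto simp: algebra_simps)
      show "H / 2 * H \<le> (H' + d) * H" using half H by (intro mult_right_mono) auto
    qed (use H \<eta> in auto)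
    also have "\<dots> = 2 * \<eta>\<^sup>2" using H by (simp add: field_simps power2_eq_square)
    finally show ?thesis .
  qed
  \<comment> \<open>Numerator errors are at most 3 * t and denominators at least h / 2, whence the
    6.\<close>
  have bnd: "x / e \<le> 6 * t / h" if "x \<le> 3 * t" "h / 2 \<le> e" for x e
  proof -
    have "x / e \<le> 3 * t / (h / 2)" using that t h by (intro frac_le) auto
    also have "\<dots> = 6 * t / h" using h by simp
    finally show ?thesis .
  qed
  have "\<bar>d / H - g / G\<bar> \<le> (t + t) / G"
    using d H G t by (intro abs_quotient_diff_le) auto
  also have "\<dots> \<le> 6 * t / h" using t G by (intro bnd) auto
  finally have 1: "\<bar>d / H - g / G\<bar> \<le> 6 * t / h" .
  have "\<bar>d / (H' + d) - g / (G' + g)\<bar> \<le> (t + 2 * t) / (G' + g)"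
    using d H G t g by (intro abs_quotient_diff_le) auto
  also have "\<dots> \<le> 6 * t / h" using t G g by (intro bnd) auto
  finally have 2: "\<bar>d / (H' + d) - g / (G' + g)\<bar> \<le> 6 * t / h" .
  have "1 - d / (H' + d) \<le> r" "1 - g / (G' + g) \<le> q"
    using r(1) q(1) H d G g by (simp_all add: field_simps)
  moreover have "r \<le> 1 - d / H" "q \<le> 1 - g / G"
    using r(2) q(2) H G by (simp_all add: field_simps)
  ultimately show ?thesis using 1 2 gap by linarith
qed

text \<open>r * a - r' * b = r * (a - b) + (r - r') * b with |r| and |b| at most 1: the errors of
  the ratios add up and are not amplified.\<close>

lemma product_recursion_diff:
  fixes a b :: "nat \<Rightarrow> real"
  assumes "a 0 = b 0"
    and "\<And>q. q < M \<Longrightarrow> \<exists>r r'. a (Suc q) = r * a q \<and> b (Suc q) = r' * b q \<and> \<bar>r\<bar> \<le> 1 \<and> \<bar>r - r'\<bar> \<le> \<xi>"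
    and "\<And>q. q < M \<Longrightarrow> \<bar>b q\<bar> \<le> 1"
  shows "q \<le> M \<Longrightarrow> \<bar>a q - b q\<bar> \<le> real q * \<xi>"
proof (induction q)
  case (Suc q)
  then obtain r r' where r: "a (Suc q) = r * a q" "b (Suc q) = r' * b q" "\<bar>r\<bar> \<le> 1" "\<bar>r - r'\<bar> \<le> \<xi>"
    using assms(2)[of q] by auto
  have "a (Suc q) - b (Suc q) = r * (a q - b q) + (r - r') * b q"
    unfolding r by (simp add: algebra_simps)
  moreover have "\<bar>r * (a q - b q)\<bar> \<le> 1 * (real q * \<xi>)"
    unfolding abs_mult using r Suc by (intro mult_mono) auto
  moreover have "\<bar>(r - r') * b q\<bar> \<le> \<xi> * 1"
    unfolding abs_mult using r assms(3)[of q] Suc.prems by (intro mult_mono) auto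
  ultimately show ?case by (simp add: algebra_simps)
qed (use assms in simp)

lemma decreasing_cell:
  fixes x :: "nat \<Rightarrow> real"
  assumes "x M \<le> y" "y \<le> x 0" "0 < M"
  shows "\<exists>q<M. x (Suc q) \<le> y \<and> y \<le> x q"
  using assms
proof (induction M)
  case (Suc M)
  show ?case
  proof (cases "x M \<le> y \<and> 0 < M")
    case True
    then show ?thesis using Suc by (meson less_SucI)
  next
    case False
    then have "y \<le> x M" using Suc.prems by (cases M) auto
    then show ?thesis using Suc.prems by auto
  qed
qed simp

text \<open>Both functions are 1 at the top of the grid, and each of the M steps down contributes
  the error of \<open>ratio_close\<close>. Between grid points monotonicity of both functions is
  used; this costs the additional \<eta>.\<close>

lemma km_cdf_close:
  fixes n M :: nat and x :: "nat \<Rightarrow> real"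
  assumes F: "\<And>i. i \<in> {1..k} \<Longrightarrow> cdf_on_unit (F i)" and i: "i \<in> {1..k}"
  defines "H \<equiv> \<lambda>x. \<Prod>j\<in>{1..k}. F j x"
    and "d \<equiv> \<lambda>q. measure (first_price_auction k F) {z. x (Suc q) < fst z \<and> fst z \<le> x q \<and> snd z = i}"
  assumes x: "x 0 = 1" "\<And>q. q < M \<Longrightarrow> x (Suc q) \<le> x q"
    and pos: "\<And>q j. q \<le> M \<Longrightarrow> j \<in> {1..k} \<Longrightarrow> 0 < F j (x q)"
    and \<eta>: "0 \<le> \<eta>" "\<eta> \<le> 1 / 2" "\<And>q. q < M \<Longrightarrow> (1 - \<eta>) * H (x q) \<le> H (x (Suc q))"
    and h: "0 < h" "\<And>q. q \<le> M \<Longrightarrow> h \<le> H (x q)" and t: "0 \<le> t" "t \<le> h / 2"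
    and n: "0 < n" and le1: "\<And>j. j < n \<Longrightarrow> fst (s j) \<le> 1"
    and cH: "\<And>q. q \<le> M \<Longrightarrow> \<bar>real (count_le n s (x q)) / real n - H (x q)\<bar> \<le> t"
    and cd: "\<And>q. q < M \<Longrightarrow> \<bar>real (card {j. j < n \<and> x (Suc q) < fst (s j) \<and> fst (s j) \<le> x q \<and> snd (s j) = i})
        / real n - d q\<bar> \<le> t"
    and y: "x M \<le> y" "y \<le> 1"
  shows "\<bar>km_cdf n s i y - F i y\<bar> \<le> real M * (2 * \<eta>\<^sup>2 + 6 * t / h) + \<eta>"
proof -
  define \<xi> where "\<xi> = 2 * \<eta>\<^sup>2 + 6 * t / h"
  have \<xi>0: "0 \<le> \<xi>" unfolding \<xi>_def using t h by simp
  note Fi = cdf_on_unit_props[OF F[OF i]]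
  have step: "\<exists>r r'. km_cdf n s i (x (Suc q)) = r * km_cdf n s i (x q) \<and> F i (x (Suc q)) = r' * F i (x q) \<and>
      \<bar>r\<bar> \<le> 1 \<and> \<bar>r - r'\<bar> \<le> \<xi> \<and> 1 - \<eta> \<le> r'" if q: "q < M" for q
  proof -
    let ?N = "\<lambda>x. real (count_le n s x)"
    let ?m = "card {j. j < n \<and> x (Suc q) < fst (s j) \<and> fst (s j) \<le> x q \<and> snd (s j) = i}"
    obtain r where r: "km_cdf n s i (x (Suc q)) = r * km_cdf n s i (x q)" "0 \<le> r" "r \<le> 1"
      "?N (x (Suc q)) / (?N (x (Suc q)) + real ?m) \<le> r" "r * ?N (x q) \<le> ?N (x q) - real ?m"
      "?m \<le> count_le n s (x q) - count_le n s (x (Suc q))"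
      using km_cdf_ratio[OF x(2)[OF q], of n s i] by blast
    have pos': "\<And>j. j \<in> {1..k} \<Longrightarrow> 0 < F j (x (Suc q))" using pos[of "Suc q"] q by simp
    obtain r' where r': "F i (x (Suc q)) = r' * F i (x q)" "0 \<le> r'" "r' \<le> 1"
      "H (x (Suc q)) / (H (x (Suc q)) + d q) \<le> r'" "r' * H (x q) \<le> H (x q) - d q"
      "0 \<le> d q" "d q \<le> H (x q) - H (x (Suc q))" "H (x (Suc q)) / H (x q) \<le> r'"
      unfolding d_def H_def by (rule first_price_auction_ratio[where F = F and k = k and i = i, OF F i x(2)[OF q] pos'])
        (assumption | rule that)+
    have Hq: "0 < H (x q)" using h(1) h(2)[of q] q by linarith
    have "1 - \<eta> \<le> H (x (Suc q)) / H (x q)"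
      using \<eta>(3)[OF q] Hq by (simp add: field_simps)
    then have "1 - \<eta> \<le> r'" using r' by linarith
    moreover have "\<bar>r - r'\<bar> \<le> \<xi>"
      unfolding \<xi>_def
    proof (rule ratio_close[where G = "?N (x q) / real n" and G' = "?N (x (Suc q)) / real n"
          and g = "real ?m / real n" and H = "H (x q)" and H' = "H (x (Suc q))" and d = "d q"])
      have "real ?m \<le> ?N (x q) - ?N (x (Suc q))"
        using r(6) count_le_mono[OF x(2)[OF q], of n s] by linarith
      then show "real ?m / real n \<le> ?N (x q) / real n - ?N (x (Suc q)) / real n"
        using n by (simp add: diff_divide_distrib[symmetric] divide_right_mono)
      have "?N (x (Suc q)) / real n / (?N (x (Suc q)) / real n + real ?m / real n) =
          ?N (x (Suc q)) / (?N (x (Suc q)) + real ?m)"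
        using n by (simp add: add_divide_distrib[symmetric])
      then show "?N (x (Suc q)) / real n / (?N (x (Suc q)) / real n + real ?m / real n) \<le> r"
        using r(4) by (simp only:)
      have "r * ?N (x q) / real n \<le> (?N (x q) - real ?m) / real n"
        using r(5) by (rule divide_right_mono) simp
      then show "r * (?N (x q) / real n) \<le> ?N (x q) / real n - real ?m / real n"
        by (simp add: diff_divide_distrib)
    qed (use h \<eta> r' t q cH[of q] cH[of "Suc q"] cd[of q] in auto)
    moreover have "\<bar>r\<bar> \<le> 1" using r(2,3) by simp
    ultimately show ?thesis using r(1) r'(1) by blast
  qed
  have grid: "\<bar>km_cdf n s i (x q) - F i (x q)\<bar> \<le> real M * \<xi>" if "q \<le> M" for q
  proof -
    have "km_cdf n s i (x 0) = F i (x 0)"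
      unfolding x(1) using km_cdf_top[of n s 1 i, OF le1] Fi(3)[of 1] by simp
    then have "\<bar>km_cdf n s i (x q) - F i (x q)\<bar> \<le> real q * \<xi>"
    proof (rule product_recursion_diff[where M = M])
      show "\<exists>r r'. km_cdf n s i (x (Suc p)) = r * km_cdf n s i (x p) \<and>
          F i (x (Suc p)) = r' * F i (x p) \<and> \<bar>r\<bar> \<le> 1 \<and> \<bar>r - r'\<bar> \<le> \<xi>" if "p < M" for p
        using step[OF that] by blast
      show "\<bar>F i (x p)\<bar> \<le> 1" for p
        using Fi(4)[of "x p"] Fi(5)[of "x p"] by simp
    qed fact
    also have "\<dots> \<le> real M * \<xi>" using that \<xi>0 by (intro mult_right_mono) auto
    finally show ?thesis .
  qed
  show ?thesis
  proof (cases "M = 0")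
    case True
    then have "y = x 0" using x y by simp
    then show ?thesis using grid[of 0] \<eta> unfolding \<xi>_def by simp
  next
    case False
    then obtain q where q: "q < M" "x (Suc q) \<le> y" "y \<le> x q"
      using decreasing_cell[of x M y] x y by auto
    have km: "km_cdf n s i (x (Suc q)) \<le> km_cdf n s i y" "km_cdf n s i y \<le> km_cdf n s i (x q)"
      using q by (auto intro: km_cdf_mono)
    have Fm: "F i (x (Suc q)) \<le> F i y" "F i y \<le> F i (x q)"
      using monoD[OF Fi(1)] q by auto
    \<comment> \<open>In one cell \<open>F i\<close> keeps at least the fraction kept by
      \<open>H\<close>, because the other factors of \<open>H\<close> only grow.\<close>
    obtain r' where "F i (x (Suc q)) = r' * F i (x q)" "1 - \<eta> \<le> r'" using step[OF q(1)] by blast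
    then have "(1 - \<eta>) * F i (x q) \<le> F i (x (Suc q))" using Fi(4)[of "x q"] by (simp add: mult_right_mono)
    moreover have "\<eta> * F i (x q) \<le> \<eta> * 1" using \<eta> Fi(5) by (intro mult_left_mono) auto
    ultimately have "F i (x q) - F i (x (Suc q)) \<le> \<eta>" by (simp add: algebra_simps)
    then show ?thesis
      using grid[of q] grid[of "Suc q"] q km Fm unfolding \<xi>_def[symmetric] by (simp add: abs_le_iff)
  qed
qed

text \<open>The slope turns a vertical error lam * c into a horizontal shift c. Closeness is known
  only from a on, so the argument is also moved by a; the rounding of the breakpoints costs 1 /
  n.\<close>

lemma wasserstein_km_est_le:
  assumes F: "cdf_on_unit F" and lam: "0 < lam"
    and lip: "\<And>x y. x \<in> {0..1} \<Longrightarrow> y \<in> {0..1} \<Longrightarrow> lam * \<bar>x - y\<bar> \<le> \<bar>F x - F y\<bar>"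
    and n: "0 < n" and Y: "\<And>j. j < n \<Longrightarrow> 0 \<le> fst (s j) \<and> fst (s j) \<le> 1"
    and close: "\<And>x. x \<in> {a..1} \<Longrightarrow> \<bar>km_cdf n s i x - F x\<bar> \<le> lam * c"
    and a: "0 \<le> a" and c: "0 \<le> c"
  shows "wasserstein (interval_measure (km_est k n s i)) (interval_measure F) \<le> ennreal (a + c + 1 / n)"
proof (rule wasserstein_le[OF cdf_on_unit_km_est F])
  note Fp = cdf_on_unit_props[OF F]
  have incr: "F x + lam * z \<le> F (x + z)" if "0 \<le> x" "0 \<le> z" "x + z \<le> 1" for x z
  proof -
    have "\<bar>x - (x + z)\<bar> = z" "\<bar>F x - F (x + z)\<bar> = F (x + z) - F x"
      using that monoD[OF Fp(1), of x "x + z"] by auto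
    then show ?thesis using lip[of x "x + z"] that by auto
  qed
  fix x :: real assume x: "x \<in> {0..1}"
  show "km_est k n s i x \<le> F (x + (a + c + 1 / n))"
  proof (cases "1 < x + (a + c + 1 / n)")
    \<comment> \<open>Beyond 1 both functions equal 1, so a shift that leaves the unit interval is
      harmless.\<close>
    case True
    then show ?thesis using Fp(3) km_est_mono[of x 1 k n s i] km_est_top[of 1 k n s i] x by auto
  next
    case False
    have "0 \<le> 1 / real n" by simp
    have "km_est k n s i x \<le> km_cdf n s i x" using n Y x by (intro km_est_le_km_cdf) auto
    also have "\<dots> \<le> km_cdf n s i (x + a)" using a by (intro km_cdf_mono) auto
    also have "\<dots> \<le> F (x + a) + lam * c"
      using close[of "x + a"] x False c \<open>0 \<le> 1 / real n\<close> by (simp add: abs_le_iff)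
    also have "\<dots> \<le> F (x + a + c)" using incr[of "x + a" c] x a c False \<open>0 \<le> 1 / real n\<close> by simp
    also have "\<dots> \<le> F (x + (a + c + 1 / n))" by (intro monoD[OF Fp(1)]) simp
    finally show ?thesis .
  qed
  show "F x \<le> km_est k n s i (x + (a + c + 1 / n))"
  proof (cases "1 < x + (a + c + 1 / n)")
    case True
    then show ?thesis using Fp(5)[of x] km_est_top[of "x + (a + c + 1 / n)" k n s i] by simp
  next
    case False
    have n0: "0 \<le> 1 / real n" by simp
    have "F x \<le> F (x + (a + c)) - lam * (a + c)" using incr[of x "a + c"] x a c False n0 by simp
    also have "\<dots> \<le> F (x + (a + c)) - lam * c" using a lam by (simp add: algebra_simps)
    also have "\<dots> \<le> km_cdf n s i (x + (a + c))"
      using close[of "x + (a + c)"] x a c False n0 by (simp add: abs_le_iff)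
    also have "\<dots> = km_cdf n s i (x + (a + c + 1 / n) - 1 / n)" by (simp add: algebra_simps)
    also have "\<dots> \<le> km_est k n s i (x + (a + c + 1 / n))"
      using n Y x a c by (intro km_cdf_le_km_est) auto
    finally show ?thesis .
  qed
qed

section \<open>Sample size\<close>

text \<open>The parameters are solved for backwards. As M is at most L / \<eta>, the gaps sum to at
  most 2 * L * \<eta> and the sampling errors to at most 12 * L * (t / h) / \<eta>. Making each
  equal to \<mu> / 4 gives the 8 in \<eta> and then 384 = 8 * 48 in t; the remaining \<eta> is below
  \<mu> / 4. The level is halved to h / 2 because the last grid point falls below h.\<close>

lemma sample_size_parameters:
  fixes k n :: nat and \<mu> \<epsilon> \<delta> f L :: real
  assumes k: "2 \<le> k" and \<mu>: "0 < \<mu>" "\<mu> \<le> 1 / 2" and \<epsilon>: "0 < \<epsilon>" "\<epsilon> < 1" and \<delta>: "0 < \<delta>" "\<delta> < 1"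
  defines "f \<equiv> (1 / \<mu>) ^ (4 * k) * (max 1 (ln (1 / \<delta>)) / \<epsilon>\<^sup>2)"
  defines "L \<equiv> ln f"
  assumes n: "1000000 * f * L ^ 5 \<le> real n"
  defines "h \<equiv> \<mu> ^ k" and "\<eta> \<equiv> \<mu> / (8 * L)" and "t \<equiv> \<mu>\<^sup>2 * \<mu> ^ k / (384 * L\<^sup>2)"
  obtains M :: nat where
    "0 < L" "\<eta> \<le> 1 / 2" "0 < t" "t \<le> h / 4" "1 / real n \<le> \<epsilon> / 8" "0 < n"
    "(1 - \<eta>) ^ M < h" "\<And>q. q \<le> M \<Longrightarrow> h / 2 \<le> (1 - \<eta>) ^ q"
    "real M * (2 * \<eta>\<^sup>2 + 6 * t / (h / 2)) + \<eta> \<le> 3 / 4 * \<mu>"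
    "4 * real (M + 1) * exp (- 2 * real n * t\<^sup>2) \<le> \<delta>"
proof -
  define D where "D = max 1 (ln (1 / \<delta>))"
  have D: "1 \<le> D" "ln (1 / \<delta>) \<le> D" unfolding D_def by auto
  have h: "0 < h" "h < 1" "h \<le> 1 / 4"
  proof -
    have "\<mu> ^ k \<le> \<mu> ^ 2" using k \<mu> by (intro power_decreasing) auto
    also have "\<dots> \<le> (1 / 2)\<^sup>2" using \<mu> by (intro power_mono) auto
    finally show "h \<le> 1 / 4" unfolding h_def by (simp add: power2_eq_square)
    then show "h < 1" by simp
  qed (use \<mu> in \<open>simp add: h_def\<close>)
  have pw: "(1 / \<mu>) ^ (4 * k) = 1 / h ^ 4"
    unfolding h_def by (simp add: power_one_over power_mult[symmetric] mult.commute)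
  have D\<epsilon>: "D \<le> D / \<epsilon>\<^sup>2" "1 / \<epsilon>\<^sup>2 \<le> D / \<epsilon>\<^sup>2"
    using D \<epsilon> by (auto simp: field_simps power_le_one mult_left_le)
  have inv1: "1 \<le> 1 / h ^ 4" using h by (simp add: power_le_one)
  have f: "D / h ^ 4 \<le> f" "1 / \<epsilon>\<^sup>2 \<le> f" "1 / h ^ 4 \<le> f"
  proof -
    have feq: "f = 1 / h ^ 4 * (D / \<epsilon>\<^sup>2)" unfolding f_def pw D_def ..
    have "1 / h ^ 4 * D \<le> f" unfolding feq using D\<epsilon> inv1 by (intro mult_left_mono) auto
    then show "D / h ^ 4 \<le> f" by simp
    have "1 * (1 / \<epsilon>\<^sup>2) \<le> f" unfolding feq using D\<epsilon> inv1 by (intro mult_mono) auto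
    then show "1 / \<epsilon>\<^sup>2 \<le> f" by simp
    have "1 / h ^ 4 * 1 \<le> f" unfolding feq using D\<epsilon> D inv1 by (intro mult_left_mono) auto
    then show "1 / h ^ 4 \<le> f" by simp
  qed
  have f0: "0 < f" using f(3) inv1 by linarith
  have "ln (1 / h ^ 4) \<le> L" unfolding L_def
    by (rule iffD2[OF ln_le_cancel_iff]) (use f(3) f0 h in auto)
  then have lnh: "4 * ln (1 / h) \<le> L" using h by (simp add: ln_div ln_realpow)
  have "ln 4 \<le> ln (1 / h)" using h by (simp add: field_simps)
  moreover have "1 < ln (4 :: real)"
  proof -
    have "exp 1 < (4 :: real)" using e_less_272 by simp
    then have "ln (exp 1) < ln (4 :: real)" by (intro iffD2[OF ln_less_cancel_iff]) auto
    then show ?thesis by (simp only: ln_exp)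
  qed
  ultimately have L: "4 \<le> L" using lnh by linarith
  have \<eta>: "0 < \<eta>" "\<eta> \<le> 1 / 64"
  proof -
    have "\<mu> / (8 * L) \<le> (1 / 2) / (8 * 4)" using \<mu> L by (intro frac_le) auto
    then show "\<eta> \<le> 1 / 64" unfolding \<eta>_def by simp
  qed (use \<mu> L in \<open>simp add: \<eta>_def\<close>)
  have ex: "\<exists>M. (1 - \<eta>) ^ M < h" using \<eta> h by (intro real_arch_pow_inv) auto
  \<comment> \<open>Minimality keeps the previous level at least h, so a single factor 1 - \<eta>
    separates the last one from it.\<close>
  define M where "M = (LEAST M. (1 - \<eta>) ^ M < h)"
  have M: "(1 - \<eta>) ^ M < h" unfolding M_def by (rule LeastI_ex[OF ex])
  then have M0: "0 < M" using h by (cases M) auto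
  have M1: "h \<le> (1 - \<eta>) ^ (M - 1)"
    using not_less_Least[of "M - 1" "\<lambda>M. (1 - \<eta>) ^ M < h"] M0 unfolding M_def[symmetric] by simp
  have lowq: "h / 2 \<le> (1 - \<eta>) ^ q" if "q \<le> M" for q
  proof -
    have "h / 2 \<le> h * (1 - \<eta>)" using h \<eta> by (simp add: field_simps)
    also have "\<dots> \<le> (1 - \<eta>) ^ (M - 1) * (1 - \<eta>)" using M1 \<eta> by (intro mult_right_mono) auto
    also have "\<dots> = (1 - \<eta>) ^ M" using M0 by (cases M) auto
    also have "\<dots> \<le> (1 - \<eta>) ^ q" using that \<eta> by (intro power_decreasing) auto
    finally show ?thesis .
  qed
  \<comment> \<open>From 1 - \<eta> \<le> exp (- \<eta>), M - 1 is at most ln (1 / h) / \<eta>, and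
    4 * ln (1 / h) \<le> L leaves room for the two extra steps.\<close>
  have M_le: "real (M + 1) \<le> L / \<eta>"
  proof -
    have "h \<le> exp (- \<eta>) ^ (M - 1)"
      using M1 power_mono[of "1 - \<eta>" "exp (- \<eta>)" "M - 1"] exp_ge_add_one_self[of "- \<eta>"] \<eta> by simp
    also have "\<dots> = exp (- (\<eta> * real (M - 1)))" by (simp add: exp_of_nat_mult[symmetric] mult.commute)
    finally have "ln h \<le> ln (exp (- (\<eta> * real (M - 1))))" using h by (intro iffD2[OF ln_le_cancel_iff]) auto
    then have "ln h \<le> - (\<eta> * real (M - 1))" by (simp only: ln_exp)
    then have "\<eta> * (real M - 1) \<le> ln (1 / h)" using M0 h by (simp add: ln_div)
    then have "\<eta> * real (M + 1) \<le> L / 4 + 2 * \<eta>" using lnh by (simp add: algebra_simps)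
    also have "\<dots> \<le> L" using \<eta> L by simp
    finally show ?thesis using \<eta> by (simp add: field_simps)
  qed
  have t: "0 < t" "t \<le> h / 4"
  proof -
    have "\<mu>\<^sup>2 \<le> 1" using \<mu> by (simp add: power_le_one)
    moreover have "1 \<le> L\<^sup>2" using L by simp
    ultimately have "\<mu>\<^sup>2 * h / (384 * L\<^sup>2) \<le> 1 * h / 384"
      using h by (intro frac_le mult_right_mono) auto
    then have "t \<le> 1 * h / 384" unfolding t_def h_def .
    then show "t \<le> h / 4" using h by simp
  qed (use \<mu> L in \<open>simp add: t_def\<close>)
  have err: "real M * (2 * \<eta>\<^sup>2 + 6 * t / (h / 2)) + \<eta> \<le> 3 / 4 * \<mu>"
  proof -
    have "real M * (2 * \<eta>\<^sup>2 + 6 * t / (h / 2)) \<le> L / \<eta> * (2 * \<eta>\<^sup>2 + 6 * t / (h / 2))"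
      using M_le t h by (intro mult_right_mono) auto
    also have "\<dots> = 2 * L * \<eta> + 12 * L * (t / h) / \<eta>"
      using \<eta> by (simp add: field_simps power2_eq_square)
    also have "2 * L * \<eta> = \<mu> / 4" unfolding \<eta>_def using L by simp
    also have "12 * L * (t / h) / \<eta> = \<mu> / 4"
      unfolding \<eta>_def t_def h_def using L \<mu> by (simp add: field_simps power2_eq_square)
    finally have "real M * (2 * \<eta>\<^sup>2 + 6 * t / (h / 2)) \<le> \<mu> / 4 + \<mu> / 4" .
    moreover have "\<eta> \<le> \<mu> / 4" unfolding \<eta>_def using \<mu> L by (intro frac_le) auto
    ultimately show ?thesis by linarith
  qed
  have L5: "1 \<le> L ^ 5" using L by simp
  have "8 / \<epsilon> \<le> 8 / \<epsilon>\<^sup>2" using \<epsilon> by (simp add: field_simps power2_eq_square)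
  also have "\<dots> = 8 * (1 / \<epsilon>\<^sup>2)" by simp
  also have "\<dots> \<le> 1000000 * f" using f(2) f0 by linarith
  also have "\<dots> \<le> 1000000 * f * L ^ 5" using f0 L5 by simp
  finally have n8: "8 / \<epsilon> \<le> real n" using n by linarith
  moreover have "0 < 8 / \<epsilon>" using \<epsilon> by simp
  ultimately have n0: "0 < n" by (cases n) auto
  have n\<epsilon>: "1 / real n \<le> \<epsilon> / 8" using n8 n0 \<epsilon> by (simp add: field_simps)
  \<comment> \<open>Of the factor 5, 4 pays for the number of events and 1 for \<delta>. The bound
    h^2 \<le> \<mu>^4, where k \<ge> 2 enters, absorbs the \<mu>^4 of t^2; 147456 is 384^2.\<close>
  have nt: "5 * D * L \<le> 2 * real n * t\<^sup>2"
  proof -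
    have "h ^ 2 \<le> \<mu> ^ 4"
      unfolding h_def power_mult[symmetric] using k \<mu> by (intro power_decreasing) auto
    then have "1 \<le> \<mu> ^ 4 / h ^ 2" using h by simp
    then have "5 * D * L * 1 \<le> 5 * D * L * (\<mu> ^ 4 / h ^ 2)"
      using D L by (intro mult_left_mono) auto
    also have "\<dots> \<le> 2 * 1000000 / 147456 * D * L * (\<mu> ^ 4 / h ^ 2)"
      using D L \<mu> h by (intro mult_right_mono) auto
    also have "\<dots> = 2 * (1000000 * (D / h ^ 4) * L ^ 5) * t\<^sup>2"
    proof -
      have "t\<^sup>2 = \<mu> ^ 4 * h ^ 2 / (147456 * L ^ 4)"
        unfolding t_def h_def[symmetric]
        by (simp add: power_mult_distrib power_divide power_mult[symmetric])
      moreover have "L ^ 5 = L * L ^ 4" "h ^ 4 = h ^ 2 * h ^ 2"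
        by (simp_all add: power_numeral_reduce)
      moreover have "L ^ 4 \<noteq> 0" "h ^ 2 \<noteq> 0" using L h by auto
      ultimately show ?thesis by (simp add: field_simps)
    qed
    also have "\<dots> \<le> 2 * real n * t\<^sup>2"
    proof -
      have "1000000 * (D / h ^ 4) * L ^ 5 \<le> 1000000 * f * L ^ 5"
        using f(1) L5 by (intro mult_right_mono mult_left_mono) linarith+
      then show ?thesis using n by (intro mult_right_mono) auto
    qed
    finally show ?thesis by simp
  qed
  have prob: "4 * real (M + 1) * exp (- 2 * real n * t\<^sup>2) \<le> \<delta>"
  proof -
    have "1 / \<mu> \<le> f"
    proof -
      have "1 / \<mu> \<le> (1 / \<mu>) ^ (4 * k)" using \<mu> k by (intro self_le_power) auto
      then show ?thesis using f(3) pw by simp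
    qed
    then have \<mu>L: "1 / \<mu> \<le> exp L" unfolding L_def using f0 by simp
    have LL: "L \<le> exp L" using exp_ge_add_one_self[of L] by linarith
    have "(32 :: real) \<le> exp L"
    proof -
      have "(1 + L / 4) ^ 4 \<le> exp (L / 4) ^ 4"
        using exp_ge_add_one_self[of "L / 4"] L by (intro power_mono) auto
      also have "\<dots> = exp L" by (simp add: exp_of_nat_mult[symmetric])
      finally have "(1 + L / 4) ^ 4 \<le> exp L" .
      moreover have "L = ln f" by (simp add: L_def)
      moreover have "256 \<le> f"
      proof -
        have "(4 :: real) ^ 4 \<le> (1 / h) ^ 4" using h by (intro power_mono) (auto simp: field_simps)
        then show ?thesis using f(3) by (simp add: power_one_over)
      qed
      ultimately show ?thesis using f0 by simp
    qed
    \<comment> \<open>Each of 32, L, L and 1 / \<mu> is at most exp L = f.\<close>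
    then have "32 * L * L * (1 / \<mu>) \<le> exp L * exp L * exp L * exp L"
      using LL \<mu>L L \<mu> by (intro mult_mono) auto
    also have "\<dots> = exp (4 * L)" by (simp add: exp_add[symmetric])
    finally have a: "32 * L * L * (1 / \<mu>) \<le> exp (4 * L)" .
    have "4 * real (M + 1) \<le> 4 * (L / \<eta>)" using M_le by simp
    also have "\<dots> = 32 * L * L * (1 / \<mu>)" unfolding \<eta>_def using L \<mu> by (simp add: field_simps)
    also note a
    finally have b: "4 * real (M + 1) \<le> exp (4 * L)" .
    have "4 * real (M + 1) * exp (- 2 * real n * t\<^sup>2) \<le> exp (4 * L) * exp (- 2 * real n * t\<^sup>2)"
      using b by (rule mult_right_mono) simp
    also have "\<dots> = exp (4 * L - 2 * real n * t\<^sup>2)" by (simp add: exp_add[symmetric])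
    also have "\<dots> \<le> exp (- D)"
    proof -
      have "4 * L \<le> 4 * D * L" using D L by simp
      moreover have "D \<le> D * L" using D L by simp
      ultimately show ?thesis using nt by simp
    qed
    also have "\<dots> \<le> exp (- ln (1 / \<delta>))" using D(2) by simp
    also have "\<dots> = \<delta>" using \<delta> by (simp add: ln_div)
    finally show ?thesis .
  qed
  show thesis
    by (rule that[of M]) (use L \<eta> t n\<epsilon> n0 M lowq err prob in auto)
qed

section \<open>The grid and the accuracy of the estimator\<close>

text \<open>Continuity excludes an atom at 0. This lets \<open>H\<close> attain all small levels,
  turns the slope condition into a lower bound on \<open>F\<close>, and makes bids positive almost
  surely.\<close>

lemma cdf_zero_if_continuous:
  assumes "cdf_on_unit F" "continuous_on UNIV F"
  shows "F 0 = 0"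
proof -
  have "isCont F 0" using assms(2) by (simp add: continuous_on_eq_continuous_at)
  then have "(F \<longlongrightarrow> F 0) (at_left 0)" unfolding isCont_def by (rule tendsto_mono[rotated]) (simp add: at_le)
  moreover have "(F \<longlongrightarrow> 0) (at_left 0)"
    by (rule tendsto_eventually)
      (use cdf_on_unit_props(2)[OF assms(1)] in \<open>auto simp: eventually_at_left_field intro: exI[of _ "- 1"]\<close>)
  ultimately show ?thesis by (rule tendsto_unique[rotated]) simp
qed

lemma quantile_grid:
  fixes H :: "real \<Rightarrow> real"
  assumes H: "continuous_on {0..1} H" "mono H" "H 0 = 0" "H 1 = 1" and \<rho>: "0 < \<rho>" "\<rho> < 1"
  obtains x :: "nat \<Rightarrow> real" where "x 0 = 1" "\<And>q. x (Suc q) \<le> x q" "\<And>q. H (x q) = \<rho> ^ q"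
proof -
  have "\<exists>x. 0 \<le> x \<and> x \<le> 1 \<and> H x = \<rho> ^ q" for q
    using H \<rho> by (intro IVT') (auto simp: power_le_one)
  then obtain y where y: "\<And>q. 0 \<le> y q \<and> y q \<le> 1 \<and> H (y q) = \<rho> ^ q" by metis
  \<comment> \<open>\<open>H\<close> may reach the value 1 before 1, so the first grid point is set
    by hand.\<close>
  define x where "x q = (if q = 0 then 1 else y q)" for q :: nat
  have x: "H (x q) = \<rho> ^ q" "x q \<le> 1" for q using y H(4) by (auto simp: x_def)
  have "x (Suc q) \<le> x q" for q
  proof (rule ccontr)
    assume "\<not> x (Suc q) \<le> x q"
    then have "H (x q) \<le> H (x (Suc q))" by (intro monoD[OF H(2)]) simp
    then show False using x \<rho> by simp
  qed
  then show thesis using x by (intro that[of x]) (auto simp: x_def)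
qed

lemma AE_first_price_auction_unit:
  assumes F: "\<And>i. i \<in> {1..k} \<Longrightarrow> cdf_on_unit (F i) \<and> continuous_on UNIV (F i)" and k: "0 < k"
  shows "AE z in first_price_auction k F. 0 \<le> fst z \<and> fst z \<le> 1"
proof -
  have Fc: "\<And>i. i \<in> {1..k} \<Longrightarrow> cdf_on_unit (F i)" using F by blast
  let ?M = "first_price_auction k F"
  interpret prob_space ?M using prob_space_first_price_auction(1)[of k F] Fc k by blast
  have sets: "{z. fst z \<le> x} \<in> events" for x
    using prob_space_first_price_auction(2)[of k F] Fc k sets_auction_le by blast
  have "prob {z. fst z \<le> 1} = (\<Prod>i\<in>{1..k}. F i 1)"
    using Fc k by (rule first_price_auction_max)
  also have "\<dots> = 1" by (rule prod.neutral) (use cdf_on_unit_props(3)[OF Fc] in auto)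
  finally have 1: "AE z in ?M. z \<in> {z. fst z \<le> 1}" by (rule AE_prob_1)
  have "prob {z. fst z \<le> 0} = (\<Prod>i\<in>{1..k}. F i 0)"
    using Fc k by (rule first_price_auction_max)
  also have "\<dots> = 0"
    by (rule prod_zero) (use cdf_zero_if_continuous F k in \<open>auto intro!: bexI[of _ 1]\<close>)
  finally have "{z. fst z \<le> 0} \<in> null_sets ?M"
    using sets by (intro null_setsI) (auto simp: emeasure_eq_measure)
  then have 0: "AE z in ?M. z \<notin> {z. fst z \<le> 0}" by (rule AE_not_in)
  from 0 1 show ?thesis by eventually_elim auto
qed

lemma km_est_accuracy:
  fixes k n :: nat
  assumes k: "2 \<le> k" and lam: "0 < lam"
    and F: "\<And>i. i \<in> {1..k} \<Longrightarrow> cdf_on_unit (F i) \<and> continuous_on UNIV (F i)"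
    and lip: "\<And>i x y. i \<in> {1..k} \<Longrightarrow> x \<in> {0..1} \<Longrightarrow> y \<in> {0..1} \<Longrightarrow> lam * \<bar>x - y\<bar> \<le> \<bar>F i x - F i y\<bar>"
    and eps: "0 < eps" "eps < 1" and \<delta>: "0 < \<delta>" "\<delta> < 1"
    and n: "1000000 * sample_rate k lam eps \<delta> * ln (sample_rate k lam eps \<delta>) powr 5 \<le> real n"
    and i: "i \<in> {1..k}"
  shows "1 - \<delta> \<le> measure (auction_samples n k F)
      {s \<in> space (auction_samples n k F). cdf_on_unit (km_est k n s i) \<and>
         wasserstein (interval_measure (km_est k n s i)) (interval_measure (F i)) \<le> ennreal eps}"
proof -
  have Fc: "\<And>i. i \<in> {1..k} \<Longrightarrow> cdf_on_unit (F i)" using F by blast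
  have k0: "0 < k" using k by simp
  have F0: "F i 0 = 0" if "i \<in> {1..k}" for i using F[OF that] by (intro cdf_zero_if_continuous) auto
  define \<mu> where "\<mu> = lam * eps / 2"
  \<comment> \<open>\<open>F i\<close> rises by exactly 1 over the unit interval.\<close>
  have "lam \<le> 1" using lip[OF i, of 1 0] F0[OF i] cdf_on_unit_props(3)[OF Fc[OF i], of 1] by simp
  then have "lam * eps \<le> 1 * 1" using eps lam by (intro mult_mono) auto
  then have \<mu>: "0 < \<mu>" "\<mu> \<le> 1 / 2" unfolding \<mu>_def using lam eps by auto
  define h where "h = \<mu> ^ k"
  have h: "0 < h" unfolding h_def using \<mu> by simp
  have rate: "sample_rate k lam eps \<delta> = (1 / \<mu>) ^ (4 * k) * (max 1 (ln (1 / \<delta>)) / eps\<^sup>2)"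
    unfolding sample_rate_def \<mu>_def by simp
  define L where "L = ln (sample_rate k lam eps \<delta>)"
  have "1 < sample_rate k lam eps \<delta>"
  proof -
    have "1 < (1 / \<mu>) ^ (4 * k)" using \<mu> k by (intro one_less_power) auto
    moreover have "eps\<^sup>2 \<le> 1" using eps by (simp add: power_le_one)
    then have "1 \<le> max 1 (ln (1 / \<delta>)) / eps\<^sup>2" using eps by (simp add: le_divide_eq)
    ultimately show ?thesis unfolding rate by (rule less_1_mult')
  qed
  then have "0 < L" unfolding L_def by simp
  then have n: "1000000 * sample_rate k lam eps \<delta> * L ^ 5 \<le> real n"
    using n unfolding L_def by (simp add: powr_numeral)
  define \<eta> where "\<eta> = \<mu> / (8 * L)"
  define t where "t = \<mu>\<^sup>2 * \<mu> ^ k / (384 * L\<^sup>2)"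
  obtain M :: nat where par: "0 < L" "\<eta> \<le> 1 / 2" "0 < t" "t \<le> h / 4" "1 / real n \<le> eps / 8" "0 < n"
    "(1 - \<eta>) ^ M < h" "\<And>q. q \<le> M \<Longrightarrow> h / 2 \<le> (1 - \<eta>) ^ q"
    "real M * (2 * \<eta>\<^sup>2 + 6 * t / (h / 2)) + \<eta> \<le> 3 / 4 * \<mu>"
    "4 * real (M + 1) * exp (- 2 * real n * t\<^sup>2) \<le> \<delta>"
    by (rule sample_size_parameters[OF k \<mu> eps \<delta> n[unfolded L_def rate], folded rate, folded L_def,
      folded \<eta>_def t_def, folded h_def]) (rule that)
  have \<eta>0: "0 < \<eta>" unfolding \<eta>_def using \<mu> \<open>0 < L\<close> by simp
  define H where "H x = (\<Prod>j\<in>{1..k}. F j x)" for x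
  have Hmono: "mono H"
  proof (rule monoI)
    fix x y :: real assume "x \<le> y"
    then show "H x \<le> H y" unfolding H_def
      by (intro prod_mono) (auto intro: monoD[OF cdf_on_unit_props(1)[OF Fc]] cdf_on_unit_props(4)[OF Fc])
  qed
  have "continuous_on {0..1} H" unfolding H_def
    by (intro continuous_on_prod) (use F in \<open>auto intro: continuous_on_subset\<close>)
  moreover have "H 0 = 0" unfolding H_def by (rule prod_zero) (use F0 k in \<open>auto intro!: bexI[of _ 1]\<close>)
  moreover have "H 1 = 1" unfolding H_def by (rule prod.neutral) (use cdf_on_unit_props(3)[OF Fc] in auto)
  moreover have "0 < 1 - \<eta>" "1 - \<eta> < 1" using par(2) \<eta>0 by auto
  ultimately obtain x where x: "x 0 = 1" "\<And>q. x (Suc q) \<le> x q" "\<And>q. H (x q) = (1 - \<eta>) ^ q"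
    using quantile_grid[of H "1 - \<eta>"] Hmono by metis
  \<comment> \<open>At eps / 2 every \<open>F j\<close> is at least lam * eps / 2 = \<mu>, so
    \<open>H\<close> is at least h there, but it is smaller than h at the last grid point.\<close>
  have xM: "x M \<le> eps / 2"
  proof (rule ccontr)
    assume "\<not> x M \<le> eps / 2"
    then have "H (eps / 2) \<le> H (x M)" by (intro monoD[OF Hmono]) simp
    also have "\<dots> < h" using par(7) unfolding x(3) .
    also have "h = (\<Prod>j\<in>{1..k}. \<mu>)" unfolding h_def by simp
    also have "\<dots> \<le> H (eps / 2)" unfolding H_def
    proof (rule prod_mono)
      fix j assume j: "j \<in> {1..k}"
      show "0 \<le> \<mu> \<and> \<mu> \<le> F j (eps / 2)"
        using lip[OF j, of "eps / 2" 0] F0[OF j] cdf_on_unit_props(4)[OF Fc[OF j], of "eps / 2"] eps \<mu>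
        by (auto simp: \<mu>_def)
    qed
    finally show False by simp
  qed
  have pos: "0 < F j (x q)" if "j \<in> {1..k}" for q j
  proof -
    have "H (x q) \<noteq> 0" unfolding x(3) using par(2) by simp
    then have "F j (x q) \<noteq> 0" unfolding H_def using that by auto
    then show ?thesis using cdf_on_unit_props(4)[OF Fc[OF that], of "x q"] by simp
  qed
  define A where "A = first_price_auction k F"
  interpret A: prob_space A
    unfolding A_def using prob_space_first_price_auction(1)[of k F] Fc k0 by blast
  have setsA: "sets A = sets (borel \<Otimes>\<^sub>M count_space UNIV)"
    unfolding A_def using prob_space_first_price_auction(2)[of k F] Fc k0 by blast
  define P where "P = (\<Pi>\<^sub>M j\<in>{..<n}. A)"
  interpret P: prob_space P unfolding P_def by (rule prob_space_PiM) (rule A.prob_space_axioms)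
  have P: "auction_samples n k F = P" unfolding auction_samples_def P_def A_def ..
  define bad where "bad E = {s \<in> space P. t \<le> \<bar>real (card {j. j < n \<and> s j \<in> E}) / real n - measure A E\<bar>}"
    for E :: "(real \<times> nat) set"
  define E1 where "E1 q = {z :: real \<times> nat. fst z \<le> x q}" for q
  define E2 where "E2 q = {z :: real \<times> nat. x (Suc q) < fst z \<and> fst z \<le> x q \<and> snd z = i}" for q
  have E: "E1 q \<in> sets A" "E2 q \<in> sets A" for q
    unfolding setsA E1_def E2_def by (rule sets_auction_le sets_auction_win)+
  have bad_sets: "bad E \<in> sets P" if "E \<in> sets A" for E
    unfolding bad_def P_def by (rule sets_sample_count[OF that])
  have bad_prob: "P.prob (bad E) \<le> 2 * exp (- 2 * real n * t\<^sup>2)" if "E \<in> sets A" for E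
    unfolding bad_def P_def
    by (rule sample_count_concentration[OF A.prob_space_axioms that par(6)]) (use par in simp)
  \<comment> \<open>At most 2 * M + 1 events, each with a two-sided tail bound of factor 2; this is
    the 4 * (M + 1) in the choice of parameters.\<close>
  let ?I = "E1 ` {..M} \<union> E2 ` {..<M}"
  have card: "card ?I \<le> 2 * (M + 1)"
  proof -
    have "card ?I \<le> card (E1 ` {..M}) + card (E2 ` {..<M})" by (rule card_Un_le)
    also have "\<dots> \<le> card {..M} + card {..<M}" by (intro add_mono card_image_le) auto
    finally show ?thesis by simp
  qed
  have IA: "E \<in> sets A" if "E \<in> ?I" for E using that assms E by auto
  have "P.prob (\<Union>E\<in>?I. bad E) \<le> (\<Sum>E\<in>?I. P.prob (bad E))"
    by (rule P.finite_measure_subadditive_finite) (use bad_sets IA in auto)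
  also have "\<dots> \<le> (\<Sum>E\<in>?I. 2 * exp (- 2 * real n * t\<^sup>2))"
    by (rule sum_mono) (use bad_prob IA in auto)
  also have "\<dots> = real (card ?I) * (2 * exp (- 2 * real n * t\<^sup>2))" by simp
  also have "\<dots> \<le> real (2 * (M + 1)) * (2 * exp (- 2 * real n * t\<^sup>2))"
    using card by (intro mult_right_mono) (auto simp del: of_nat_add of_nat_mult)
  also have "\<dots> \<le> \<delta>" using par(10) by (simp add: algebra_simps)
  finally have Bad: "P.prob (\<Union>E\<in>?I. bad E) \<le> \<delta>" .
  let ?good = "\<lambda>s. wasserstein (interval_measure (km_est k n s i)) (interval_measure (F i)) \<le> ennreal eps"
  let ?G = "{s \<in> space P. cdf_on_unit (km_est k n s i) \<and> ?good s}"
  have G: "?G \<in> sets P"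
    unfolding P_def
    by (rule sets_km_est[OF setsA, where Q = "\<lambda>f. cdf_on_unit f \<and> wasserstein (interval_measure f) (interval_measure (F i)) \<le> ennreal eps"])
  have good: "?good s"
    if s: "s \<in> space P" "s \<notin> (\<Union>E\<in>?I. bad E)" and Y: "\<And>j. j < n \<Longrightarrow> 0 \<le> fst (s j) \<and> fst (s j) \<le> 1" for s
  proof -
    have nb: "\<bar>real (card {j. j < n \<and> s j \<in> E}) / real n - measure A E\<bar> \<le> t" if "E \<in> ?I" for E
    proof -
      have "s \<notin> bad E" using s(2) that by blast
      then show ?thesis unfolding bad_def using s(1) by simp
    qed
    have cH: "\<bar>real (count_le n s (x q)) / real n - (\<Prod>j\<in>{1..k}. F j (x q))\<bar> \<le> t" if "q \<le> M" for q
    proof -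
      have "E1 q \<in> ?I" using that by auto
      moreover have "measure A (E1 q) = (\<Prod>j\<in>{1..k}. F j (x q))"
        unfolding A_def E1_def using Fc k0 by (rule first_price_auction_max)
      moreover have "{j. j < n \<and> s j \<in> E1 q} = {j. j < n \<and> fst (s j) \<le> x q}" by (simp add: E1_def)
      ultimately show ?thesis unfolding count_le_def using nb[of "E1 q"] by (simp only:)
    qed
    have cd: "\<bar>real (card {j. j < n \<and> x (Suc q) < fst (s j) \<and> fst (s j) \<le> x q \<and> snd (s j) = i}) / real n -
        measure (first_price_auction k F) {z. x (Suc q) < fst z \<and> fst z \<le> x q \<and> snd z = i}\<bar> \<le> t"
      if "q < M" for q
    proof -
      have "E2 q \<in> ?I" using that by auto
      moreover have "{j. j < n \<and> s j \<in> E2 q} =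
          {j. j < n \<and> x (Suc q) < fst (s j) \<and> fst (s j) \<le> x q \<and> snd (s j) = i}" by (simp add: E2_def)
      ultimately show ?thesis using nb[of "E2 q"] unfolding A_def E2_def by (simp only:)
    qed
    have close: "\<bar>km_cdf n s i y - F i y\<bar> \<le> lam * (3 / 8 * eps)" if y: "y \<in> {eps / 2..1}" for y
    proof -
      have "\<bar>km_cdf n s i y - F i y\<bar> \<le> real M * (2 * \<eta>\<^sup>2 + 6 * t / (h / 2)) + \<eta>"
      proof (rule km_cdf_close[where F = F and k = k and x = x, OF Fc i x(1) x(2) pos _ par(2)])
        show "(1 - \<eta>) * (\<Prod>j\<in>{1..k}. F j (x q)) \<le> (\<Prod>j\<in>{1..k}. F j (x (Suc q)))" for q
          using x(3)[of q] x(3)[of "Suc q"] unfolding H_def by simp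
        show "h / 2 \<le> (\<Prod>j\<in>{1..k}. F j (x q))" if "q \<le> M" for q
          using par(8)[OF that] x(3)[of q] unfolding H_def by simp
        show "x M \<le> y" "y \<le> 1" using xM y by auto
      qed (use par(3,4,6) \<eta>0 h Y cH cd in auto)
      also have "\<dots> \<le> 3 / 4 * \<mu>" by (rule par(9))
      also have "\<dots> = lam * (3 / 8 * eps)" by (simp add: \<mu>_def)
      finally show ?thesis .
    qed
    \<comment> \<open>The budget: eps / 2 for the region below the grid, 3 / 8 * eps for the
      vertical error, and at most eps / 8 for rounding.\<close>
    have "wasserstein (interval_measure (km_est k n s i)) (interval_measure (F i)) \<le>
        ennreal (eps / 2 + 3 / 8 * eps + 1 / real n)"
      using Fc[OF i] lam lip[OF i] par(6) Y close by (rule wasserstein_km_est_le) (use eps in auto)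
    also have "\<dots> \<le> ennreal eps" using par(5) by (intro ennreal_leI) simp
    finally show ?thesis .
  qed
  \<comment> \<open>Bids lie in the unit interval only almost surely, so the events are compared up
    to a null set.\<close>
  have "AE s in P. \<forall>j\<in>{..<n}. 0 \<le> fst (s j) \<and> fst (s j) \<le> 1"
    unfolding P_def
  proof (rule AE_ball_countable[THEN iffD2], simp, intro ballI AE_PiM_component)
    show "prob_space A" by (rule A.prob_space_axioms)
    show "AE z in A. 0 \<le> fst z \<and> fst z \<le> 1"
      unfolding A_def using F k0 by (rule AE_first_price_auction_unit)
  qed auto
  then have "AE s in P. s \<in> space P - (\<Union>E\<in>?I. bad E) \<longrightarrow> s \<in> ?G"
    by (rule AE_mp, intro AE_I2) (use good cdf_on_unit_km_est in auto)
  then have "P.prob (space P - (\<Union>E\<in>?I. bad E)) \<le> P.prob ?G"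
    using G by (rule P.finite_measure_mono_AE)
  moreover have "P.prob (space P - (\<Union>E\<in>?I. bad E)) = 1 - P.prob (\<Union>E\<in>?I. bad E)"
    by (rule P.prob_compl) (use bad_sets IA in auto)
  ultimately show ?thesis using Bad unfolding P by simp
qed

theorem theorem2p2:
  shows "\<exists>A Fhat. \<exists>C\<ge>1 :: real. \<exists>c\<ge>1 :: real.
    computes_in_poly_time A Fhat \<and>
    (\<forall>(k :: nat) (lam :: real) (F :: nat \<Rightarrow> real \<Rightarrow> real) (eps :: real) (\<delta> :: real) (n :: nat).
       k \<ge> 2 \<longrightarrow> lam > 0 \<longrightarrow>
       (\<forall>i\<in>{1..k}. cdf_on_unit (F i) \<and> continuous_on UNIV (F i)) \<longrightarrow>
       (\<forall>i\<in>{1..k}. \<forall>x\<in>{0..1}. \<forall>y\<in>{0..1}. \<bar>F i x - F i y\<bar> \<ge> lam * \<bar>x - y\<bar>) \<longrightarrow>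
       eps \<in> {0<..<1} \<longrightarrow> \<delta> \<in> {0<..<1} \<longrightarrow>
       real n \<ge> C * sample_rate k lam eps \<delta> * ln (sample_rate k lam eps \<delta>) powr c \<longrightarrow>
       (\<forall>i\<in>{1..k}.
          measure (auction_samples n k F)
            {s \<in> space (auction_samples n k F).
               cdf_on_unit (Fhat k n s i) \<and>
               wasserstein (interval_measure (Fhat k n s i)) (interval_measure (F i)) \<le> ennreal eps}
          \<ge> 1 - \<delta>))"
proof (rule exI[of _ km_prog], rule exI[of _ km_est], rule exI[of _ 1000000], intro conjI,
    simp, rule exI[of _ 5], intro conjI, simp, rule km_prog_computes, intro allI impI ballI)
  fix k n :: nat and lam eps \<delta> :: real and F :: "nat \<Rightarrow> real \<Rightarrow> real" and i
  assume *: "k \<ge> 2" "lam > 0" "\<forall>i\<in>{1..k}. cdf_on_unit (F i) \<and> continuous_on UNIV (F i)"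
    "\<forall>i\<in>{1..k}. \<forall>x\<in>{0..1}. \<forall>y\<in>{0..1}. \<bar>F i x - F i y\<bar> \<ge> lam * \<bar>x - y\<bar>"
    "eps \<in> {0<..<1}" "\<delta> \<in> {0<..<1}" "i \<in> {1..k}"
    and n: "real n \<ge> 1000000 * sample_rate k lam eps \<delta> * ln (sample_rate k lam eps \<delta>) powr 5"
  then show "1 - \<delta> \<le> measure (auction_samples n k F)
      {s \<in> space (auction_samples n k F). cdf_on_unit (km_est k n s i) \<and>
         wasserstein (interval_measure (km_est k n s i)) (interval_measure (F i)) \<le> ennreal eps}"
    using n by (intro km_est_accuracy) auto
qed

end
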